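(* Let $G$ be a reflexive Abelian $P$-group. (a) If $G$ is a dense subgroup of a topological Abelian group $H$, then $H$ is also a reflexive $P$-group. (b) If $\pi:G\to K$ is a continuous open homomorphism of $G$ onto a topological Abelian group $K$, then $K$ is a reflexive $P$-group.
   Context: Topological groups are assumed Hausdorff. In (a), $G$ carries the topology inherited from $H$. A $P$-group is a topological group in which every $G_\delta$-set is open. $\mathbb T=\{z\in\mathbb C:|z|=1\}$ is the circle group. For a topological Abelian group $G$, $G^\wedge$ is the group of continuous characters (continuous homomorphisms $G\to\mathbb T$) with the topology of uniform convergence on compact subsets of $G$. $G$ is reflexive if the evaluation homomorphism $\alpha_G:G\to G^{\wedge\wedge}$, $\alpha_G(x)(\chi)=\chi(x)$, is a topological isomorphism of $G$ onto $G^{\wedge\wedge}=(G^\wedge)^\wedge$. *)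

theory Defs
  imports "HOL-Analysis.Analysis" "HOL-Algebra.Group"
begin

text \<open>
  A topological group is a group \<open>G\<close> together with an abstract topology \<open>T\<close> on \<open>carrier G\<close>;
  the Hausdorff property is part of the definition.
\<close>

definition topological_group :: "('a, 'm) monoid_scheme \<Rightarrow> 'a topology \<Rightarrow> bool" where
  "topological_group G T \<longleftrightarrow>
     group G \<and> topspace T = carrier G \<and> Hausdorff_space T \<and>
     continuous_map (prod_topology T T) T (\<lambda>(x, y). x \<otimes>\<^bsub>G\<^esub> y) \<and>
     continuous_map T T (\<lambda>x. inv\<^bsub>G\<^esub> x)"

definition topological_abelian_group :: "('a, 'm) monoid_scheme \<Rightarrow> 'a topology \<Rightarrow> bool" where
  "topological_abelian_group G T \<longleftrightarrow> topological_group G T \<and> comm_group G"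

definition P_group :: "('a, 'm) monoid_scheme \<Rightarrow> 'a topology \<Rightarrow> bool" where
  "P_group G T \<longleftrightarrow> topological_group G T \<and> (\<forall>S. gdelta_in T S \<longrightarrow> openin T S)"

definition circle_group :: "complex monoid" where
  "circle_group = \<lparr>carrier = sphere 0 1, mult = (*), one = 1\<rparr>"

text \<open>
  Characters are taken to be extensional (equal to \<open>undefined\<close> outside \<open>carrier G\<close>), so that
  two characters are equal as HOL functions iff they agree on \<open>carrier G\<close>.
\<close>

definition characters :: "('a, 'm) monoid_scheme \<Rightarrow> 'a topology \<Rightarrow> ('a \<Rightarrow> complex) set" where
  "characters G T =
     {\<phi> \<in> hom G circle_group. \<phi> \<in> extensional (carrier G) \<and>
        continuous_map T (top_of_set (sphere 0 1)) \<phi>}"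

definition dual_group :: "('a, 'm) monoid_scheme \<Rightarrow> 'a topology \<Rightarrow> ('a \<Rightarrow> complex) monoid" where
  "dual_group G T =
     \<lparr>carrier = characters G T,
      mult = (\<lambda>\<phi> \<psi>. \<lambda>x\<in>carrier G. \<phi> x * \<psi> x),
      one = (\<lambda>x\<in>carrier G. 1)\<rparr>"

text \<open>
  Uniform convergence on compact sets: the sets
  \<open>{\<psi>. \<forall>x\<in>C. dist (\<psi> x) (\<phi> x) < e}\<close>, with \<open>C\<close> compact and \<open>e > 0\<close>, form a
  neighbourhood base at the character \<open>\<phi>\<close>.
\<close>

definition dual_topology :: "('a, 'm) monoid_scheme \<Rightarrow> 'a topology \<Rightarrow> ('a \<Rightarrow> complex) topology" where
  "dual_topology G T =
     topology (\<lambda>U. U \<subseteq> characters G T \<and>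
       (\<forall>\<phi>\<in>U. \<exists>C e. compactin T C \<and> 0 < e \<and>
          {\<psi> \<in> characters G T. \<forall>x\<in>C. dist (\<psi> x) (\<phi> x) < e} \<subseteq> U))"

lemma openin_dual_topology:
  "openin (dual_topology G T) U \<longleftrightarrow>
     U \<subseteq> characters G T \<and>
     (\<forall>\<phi>\<in>U. \<exists>C e. compactin T C \<and> 0 < e \<and>
        {\<psi> \<in> characters G T. \<forall>x\<in>C. dist (\<psi> x) (\<phi> x) < e} \<subseteq> U)"
proof -
  let ?N = "\<lambda>C e \<phi>. {\<psi> \<in> characters G T. \<forall>x\<in>C. dist (\<psi> x) (\<phi> x) < e}"
  let ?L = "\<lambda>U. U \<subseteq> characters G T \<and>
    (\<forall>\<phi>\<in>U. \<exists>C e. compactin T C \<and> 0 < e \<and> ?N C e \<phi> \<subseteq> U)"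
  have "istopology ?L"
    unfolding istopology_def
  proof (intro conjI allI impI)
    fix U V assume U: "?L U" and V: "?L V"
    show "U \<inter> V \<subseteq> characters G T" using U by blast
    show "\<forall>\<phi>\<in>U \<inter> V. \<exists>C e. compactin T C \<and> 0 < e \<and> ?N C e \<phi> \<subseteq> U \<inter> V"
    proof
      fix \<phi> assume "\<phi> \<in> U \<inter> V"
      then obtain C e D d where
        C: "compactin T C" "0 < e" "?N C e \<phi> \<subseteq> U" and
        D: "compactin T D" "0 < d" "?N D d \<phi> \<subseteq> V"
        using U V by (meson IntD1 IntD2)
      have "compactin T (C \<union> D)" "0 < min e d"
        using C D by (auto intro: compactin_Un)
      moreover have "?N (C \<union> D) (min e d) \<phi> \<subseteq> ?N C e \<phi> \<inter> ?N D d \<phi>" by auto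
      ultimately show "\<exists>C e. compactin T C \<and> 0 < e \<and> ?N C e \<phi> \<subseteq> U \<inter> V"
        using C(3) D(3) by (meson Int_mono order_trans)
    qed
  next
    fix \<K> assume K: "\<forall>U\<in>\<K>. ?L U"
    then show "\<Union>\<K> \<subseteq> characters G T" by blast
    show "\<forall>\<phi>\<in>\<Union>\<K>. \<exists>C e. compactin T C \<and> 0 < e \<and> ?N C e \<phi> \<subseteq> \<Union>\<K>"
      using K by (meson UnionE Union_upper order_trans)
  qed
  then show ?thesis
    unfolding dual_topology_def by (simp add: topology_inverse')
qed

lemma topspace_dual_topology: "topspace (dual_topology G T) = characters G T"
proof -
  have "openin (dual_topology G T) (characters G T)"
    unfolding openin_dual_topology
    by (auto intro!: exI[of _ "{}"] exI[of _ "1::real"])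
  then show ?thesis
    by (metis openin_dual_topology openin_subset openin_topspace subset_antisym)
qed

abbreviation bidual_group ::
  "('a, 'm) monoid_scheme \<Rightarrow> 'a topology \<Rightarrow> (('a \<Rightarrow> complex) \<Rightarrow> complex) monoid" where
  "bidual_group G T \<equiv> dual_group (dual_group G T) (dual_topology G T)"

abbreviation bidual_topology ::
  "('a, 'm) monoid_scheme \<Rightarrow> 'a topology \<Rightarrow> (('a \<Rightarrow> complex) \<Rightarrow> complex) topology" where
  "bidual_topology G T \<equiv> dual_topology (dual_group G T) (dual_topology G T)"

definition evaluation ::
  "('a, 'm) monoid_scheme \<Rightarrow> 'a topology \<Rightarrow> 'a \<Rightarrow> ('a \<Rightarrow> complex) \<Rightarrow> complex" where
  "evaluation G T x = (\<lambda>\<phi>\<in>characters G T. \<phi> x)"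

definition reflexive_group :: "('a, 'm) monoid_scheme \<Rightarrow> 'a topology \<Rightarrow> bool" where
  "reflexive_group G T \<longleftrightarrow>
     topological_abelian_group G T \<and>
     evaluation G T \<in> iso G (bidual_group G T) \<and>
     homeomorphic_map T (bidual_topology G T) (evaluation G T)"

text \<open>
  \<open>G\<close> is a subgroup of \<open>H\<close> with the group operation and the topology inherited from \<open>H\<close>,
  and its carrier is dense. The operations need only agree on \<open>carrier G\<close>.
\<close>

definition dense_topological_subgroup ::
  "('a, 'm) monoid_scheme \<Rightarrow> 'a topology \<Rightarrow> ('a, 'n) monoid_scheme \<Rightarrow> 'a topology \<Rightarrow> bool" where
  "dense_topological_subgroup G TG H TH \<longleftrightarrow>
     subgroup (carrier G) H \<and>
     (\<forall>x\<in>carrier G. \<forall>y\<in>carrier G. x \<otimes>\<^bsub>G\<^esub> y = x \<otimes>\<^bsub>H\<^esub> y) \<and>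
     TG = subtopology TH (carrier G) \<and>
     TH closure_of carrier G = carrier H"

end

theory Submission
  imports Defs
begin

text \<open>
  Compact subsets of a Hausdorff \<open>P\<close>-space are finite, so the dual of an Abelian \<open>P\<close>-group \<open>G\<close>
  carries the topology of pointwise convergence, and by a theorem of Comfort and Ross every
  continuous character of the dual is an evaluation. Moreover the open subgroups of \<open>G\<close> form a
  neighbourhood base at \<open>\<one>\<close>, and the annihilator of an open subgroup is compact (Tychonoff) and
  separates the subgroup from the points outside it (divisibility of the circle). Hence the
  evaluation map is always an open isomorphism onto the bidual, and it is continuous iff for every
  compact set \<open>C\<close> of characters the common kernel of \<open>C\<close> is open.

  This criterion passes along a continuous homomorphism \<open>h\<close> from \<open>G\<close> to an Abelian \<open>P\<close>-group \<open>H\<close>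
  whenever a closed subgroup of \<open>H\<close> with open preimage is itself open: \<open>h\<close> pulls \<open>C\<close> back to a
  compact set of characters of \<open>G\<close>, and the common kernel of that set is the preimage of the common
  kernel of \<open>C\<close>. Both inclusions of dense subgroups and open surjections have this property.
\<close>

section \<open>Abelian P-groups\<close>

text \<open>Open subgroups come from countable intersections: neighbourhoods \<open>V n\<close> with
  \<open>V (Suc n)\<close> divided by itself inside \<open>V n\<close> intersect in a subgroup,
  which the P-property keeps open. The same device explains the criterion on common kernels:
  continuity of the evaluation says that the characters of a compact set are jointly close to 1 near
  the identity, and intersecting over the radii \<open>1 / n\<close> replaces close by equal. The
  dual group need not be compact, so its characters cannot be analysed by Haar integration over it.
  Averages over finite nets and over powers of a single element take the place of the integral, and
  only elementary estimates on the circle remain. The recurring radius 1 comes from the circle: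
  every \<open>z \<noteq> 1\<close> on it has a power at distance at least 1 from 1. The transfer to
  \<open>H\<close> only pulls characters back; extending characters of \<open>G\<close> or lifting
  compact sets of them never arises.\<close>

lemma gdelta_in_INT_nat:
  fixes U :: "nat \<Rightarrow> 'a set"
  assumes "\<And>n. openin X (U n)"
  shows "gdelta_in X (\<Inter>n. U n)"
  using assms by (intro gdelta_in_Inter) (auto intro: open_imp_gdelta_in)

lemma gdelta_in_imp_INT_nat:
  assumes "gdelta_in X S"
  obtains U :: "nat \<Rightarrow> 'a set" where "\<And>n. openin X (U n)" "S = (\<Inter>n. U n)"
proof -
  obtain \<U> where \<U>: "countable \<U>" "\<U> \<subseteq> Collect (openin X)" "\<Inter>\<U> = S" "S \<subseteq> topspace X"
    using assms by (auto simp: gdelta_in_alt intersection_of_def)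
  \<comment> \<open>Adding the whole space makes the countable family nonempty, as the enumeration
    by \<open>from_nat_into\<close> requires. The intersection is unchanged because \<open>S\<close>
    lies in the space.\<close>
  define \<V> where "\<V> = insert (topspace X) \<U>"
  have \<V>: "countable \<V>" "\<V> \<noteq> {}" "\<V> \<subseteq> Collect (openin X)"
    using \<U> by (simp_all add: \<V>_def)
  have "S = \<Inter>\<V>"
    using \<U> by (simp add: \<V>_def inf_absorb2)
  then have "S = (\<Inter>n. from_nat_into \<V> n)"
    by (simp add: range_from_nat_into \<V>)
  moreover have "openin X (from_nat_into \<V> n)" for n
    using from_nat_into[OF \<V>(2)] \<V>(3) by (meson mem_Collect_eq subsetD)
  ultimately show thesis
    by (intro that)
qed

text \<open>The complement of a countable set is a countable intersection of complements of points,
  so countable sets are closed. An infinite compact set would contain a countable infinite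
  \<open>D\<close>, and the open sets that miss all of \<open>D\<close> but one point would cover it
  without a finite subcover.\<close>

lemma compactin_P_space_imp_finite:
  assumes X: "Hausdorff_space X" and P: "\<And>S. gdelta_in X S \<Longrightarrow> openin X S"
    and C: "compactin X C"
  shows "finite C"
proof (rule ccontr)
  assume "infinite C"
  then obtain D where D: "D \<subseteq> C" "infinite D" "countable D"
    by (meson infinite_countable_subset')
  have CX: "C \<subseteq> topspace X"
    using C compactin_subset_topspace by blast
  have "openin X (topspace X - E)" if "E \<subseteq> D" for E
  proof (cases "E = {}")
    case False
    have "gdelta_in X (\<Inter>d\<in>E. topspace X - {d})"
    proof (rule gdelta_in_Inter)
      show "countable ((\<lambda>d. topspace X - {d}) ` E)"
        using D that countable_subset by blast
      have "closedin X {d}" if "d \<in> E" for d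
        using \<open>E \<subseteq> D\<close> that D CX closedin_Hausdorff_sing_eq X by fastforce
      then show "gdelta_in X S" if "S \<in> (\<lambda>d. topspace X - {d}) ` E" for S
        using that by (auto intro!: open_imp_gdelta_in)
    qed (use False in auto)
    moreover have "(\<Inter>d\<in>E. topspace X - {d}) = topspace X - E"
      using False by auto
    ultimately show ?thesis
      using P by auto
  qed auto
  then have op: "\<forall>U \<in> (\<lambda>d. topspace X - (D - {d})) ` D. openin X U"
    by auto
  have "C \<subseteq> \<Union>((\<lambda>d. topspace X - (D - {d})) ` D)"
  proof
    fix x assume "x \<in> C"
    \<comment> \<open>A point outside \<open>D\<close> lies in every member of the cover, so any
      \<open>d\<close> will do for it.\<close>
    moreover obtain d where "d \<in> D" "x \<in> D \<longrightarrow> d = x"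
      using D by (metis finite.emptyI ex_in_conv)
    ultimately show "x \<in> \<Union>((\<lambda>d. topspace X - (D - {d})) ` D)"
      using CX by blast
  qed
  with C op obtain \<F> where \<F>: "finite \<F>" "\<F> \<subseteq> (\<lambda>d. topspace X - (D - {d})) ` D" "C \<subseteq> \<Union>\<F>"
    unfolding compactin_def by meson
  obtain E where E: "finite E" "E \<subseteq> D" "\<F> = (\<lambda>d. topspace X - (D - {d})) ` E"
    using finite_subset_image[OF \<F>(1,2)] by blast
  have "D \<subseteq> E"
    using D \<F>(3) E by blast
  with E D show False
    using finite_subset by blast
qed

section \<open>Translations and neighbourhoods of the identity in a topological Abelian
  group\<close>

locale topological_ab_group = comm_group G for G (structure) +
  fixes T :: "'a topology"
  assumes topological: "topological_group G T"
begin

lemma topspace_eq: "topspace T = carrier G"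
  using topological by (simp add: topological_group_def)

lemma Hausdorff: "Hausdorff_space T"
  using topological by (simp add: topological_group_def)

lemma continuous_mult: "continuous_map (prod_topology T T) T (\<lambda>(x, y). x \<otimes> y)"
  using topological by (simp add: topological_group_def)

lemma continuous_inv: "continuous_map T T (\<lambda>x. inv x)"
  using topological by (simp add: topological_group_def)

lemma openin_carrier: "openin T U \<Longrightarrow> U \<subseteq> carrier G"
  using openin_subset topspace_eq by blast

lemma continuous_translation:
  assumes "a \<in> carrier G"
  shows "continuous_map T T (\<lambda>x. a \<otimes> x)"
proof -
  have "continuous_map T (prod_topology T T) (\<lambda>x. (a, x))"
    using assms by (simp add: continuous_map_pairwise o_def topspace_eq)
  from continuous_map_compose[OF this continuous_mult] show ?thesis
    by (simp add: o_def)
qed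

lemma openin_translation:
  assumes "a \<in> carrier G" "openin T U"
  shows "openin T {x \<in> carrier G. a \<otimes> x \<in> U}"
  using openin_continuous_map_preimage[OF continuous_translation] assms topspace_eq by simp

lemma continuous_division:
  "continuous_map (prod_topology T T) T (\<lambda>(x, y). x \<otimes> inv y)"
proof -
  have "continuous_map (prod_topology T T) (prod_topology T T) (\<lambda>p. (fst p, inv (snd p)))"
    using continuous_map_compose[OF continuous_map_snd continuous_inv]
    by (auto simp: continuous_map_pairwise o_def continuous_map_fst)
  from continuous_map_compose[OF this continuous_mult] show ?thesis
    by (simp add: o_def case_prod_unfold)
qed

text \<open>Division is used because one inclusion then handles products and inverses together, and
  also bounds the closure of \<open>V\<close>.\<close>

lemma division_nhd:
  assumes "openin T U" "\<one> \<in> U"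
  obtains V where "openin T V" "\<one> \<in> V" "\<And>x y. x \<in> V \<Longrightarrow> y \<in> V \<Longrightarrow> x \<otimes> inv y \<in> U"
proof -
  let ?P = "{p \<in> topspace (prod_topology T T). (\<lambda>(x, y). x \<otimes> inv y) p \<in> U}"
  have "openin (prod_topology T T) ?P"
    using openin_continuous_map_preimage[OF continuous_division assms(1)] .
  moreover have "(\<one>, \<one>) \<in> ?P"
    using assms topspace_eq by simp
  ultimately obtain V W where "openin T V" "openin T W" "\<one> \<in> V" "\<one> \<in> W" "V \<times> W \<subseteq> ?P"
    unfolding openin_prod_topology_alt by meson
  then show thesis
    by (intro that[of "V \<inter> W"]) (auto intro: openin_Int)
qed

text \<open>Around each of its points \<open>x\<close>, the subgroup contains the translate of
  \<open>U\<close> by \<open>x\<close>.\<close>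

lemma openin_subgroup:
  assumes "subgroup M G" "openin T U" "\<one> \<in> U" "U \<subseteq> M"
  shows "openin T M"
proof (subst openin_subopen, intro ballI)
  fix x assume x: "x \<in> M"
  then have xG: "x \<in> carrier G"
    using assms(1) subgroup.subset by blast
  let ?V = "{y \<in> carrier G. inv x \<otimes> y \<in> U}"
  have "openin T ?V"
    using openin_translation xG assms(2) by simp
  moreover have "x \<in> ?V"
    using xG assms(3) by simp
  moreover have "?V \<subseteq> M"
  proof
    fix y assume y: "y \<in> ?V"
    then have "x \<otimes> (inv x \<otimes> y) \<in> M"
      using assms x by (auto intro: subgroup.m_closed)
    then show "y \<in> M"
      using y xG by (simp add: inv_solve_left m_assoc[symmetric])
  qed
  ultimately show "\<exists>V. openin T V \<and> x \<in> V \<and> V \<subseteq> M"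
    by blast
qed

text \<open>The closure of \<open>V\<close> lies in \<open>V\<close> divided by \<open>V\<close>: if
  \<open>x\<close> is in the closure, its neighbourhood \<open>x V\<close> meets \<open>V\<close> in
  some \<open>y\<close>, and \<open>x\<close> is the quotient of \<open>y\<close> by
  \<open>inv x \<otimes> y\<close>.\<close>

lemma closedin_nhd:
  assumes "openin T U" "\<one> \<in> U"
  obtains V W where "openin T V" "closedin T W" "\<one> \<in> V" "V \<subseteq> W" "W \<subseteq> U"
proof -
  obtain V where V: "openin T V" "\<one> \<in> V" "\<And>x y. x \<in> V \<Longrightarrow> y \<in> V \<Longrightarrow> x \<otimes> inv y \<in> U"
    using division_nhd assms by blast
  have "T closure_of V \<subseteq> U"
  proof
    fix x assume x: "x \<in> T closure_of V"
    then have xG: "x \<in> carrier G"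
      by (simp add: in_closure_of topspace_eq)
    have "openin T {y \<in> carrier G. inv x \<otimes> y \<in> V}"
      using V xG openin_translation by simp
    moreover have "x \<in> {y \<in> carrier G. inv x \<otimes> y \<in> V}"
      using V xG by simp
    moreover have "\<exists>y. y \<in> V \<and> y \<in> W" if "openin T W" "x \<in> W" for W
      using x that by (simp add: in_closure_of)
    ultimately obtain y where y: "y \<in> V" "y \<in> {y \<in> carrier G. inv x \<otimes> y \<in> V}"
      by meson
    then have "y \<otimes> inv (inv x \<otimes> y) \<in> U"
      using V by blast
    then show "x \<in> U"
      using y xG by (simp add: inv_mult m_lcomm[of y x])
  qed
  then show thesis
    using V by (intro that[of V "T closure_of V"])
      (auto simp: closure_of_subset openin_subset)
qed

text \<open>By homogeneity a G-delta set needs testing only at the identity, where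
  \<open>closedin_nhd\<close> supplies closed neighbourhoods for the dense subgroup
  argument.\<close>

lemma P_groupI:
  assumes "\<And>U :: nat \<Rightarrow> 'a set. (\<And>n. openin T (U n)) \<Longrightarrow> (\<And>n. \<one> \<in> U n) \<Longrightarrow>
    \<exists>V. openin T V \<and> \<one> \<in> V \<and> V \<subseteq> (\<Inter>n. U n)"
  shows "P_group G T"
  unfolding P_group_def
proof (intro conjI allI impI topological)
  fix S assume "gdelta_in T S"
  then obtain U :: "nat \<Rightarrow> 'a set" where U: "\<And>n. openin T (U n)" "S = (\<Inter>n. U n)"
    using gdelta_in_imp_INT_nat by blast
  show "openin T S"
  proof (subst openin_subopen, intro ballI)
    fix x assume x: "x \<in> S"
    then have xG: "x \<in> carrier G"
      using U openin_carrier by blast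
    have "\<exists>V. openin T V \<and> \<one> \<in> V \<and> V \<subseteq> (\<Inter>n. {y \<in> carrier G. x \<otimes> y \<in> U n})"
      by (rule assms) (use x xG U openin_translation in auto)
    then obtain V where V: "openin T V" "\<one> \<in> V" "V \<subseteq> (\<Inter>n. {y \<in> carrier G. x \<otimes> y \<in> U n})"
      by blast
    have "openin T {y \<in> carrier G. inv x \<otimes> y \<in> V}"
      using V xG openin_translation by simp
    moreover have "x \<in> {y \<in> carrier G. inv x \<otimes> y \<in> V}"
      using V xG by simp
    moreover have "{y \<in> carrier G. inv x \<otimes> y \<in> V} \<subseteq> S"
    proof
      fix y assume y: "y \<in> {y \<in> carrier G. inv x \<otimes> y \<in> V}"
      then have "x \<otimes> (inv x \<otimes> y) \<in> S"
        using V U by auto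
      then show "y \<in> S"
        using y xG by (simp add: m_assoc[symmetric])
    qed
    ultimately show "\<exists>V. openin T V \<and> x \<in> V \<and> V \<subseteq> S"
      by blast
  qed
qed

end

locale P_ab_group = topological_ab_group +
  assumes P_group: "P_group G T"
begin

lemma gdelta_open: "gdelta_in T S \<Longrightarrow> openin T S"
  using P_group by (simp add: P_group_def)

lemma openin_INT_nat:
  fixes U :: "nat \<Rightarrow> 'a set"
  shows "(\<And>n. openin T (U n)) \<Longrightarrow> openin T (\<Inter>n. U n)"
  by (simp add: gdelta_open gdelta_in_INT_nat)

lemma compactin_finite: "compactin T C \<Longrightarrow> finite C"
  using compactin_P_space_imp_finite Hausdorff gdelta_open by blast

text \<open>The intersection of the sequence \<open>V\<close> is closed under division, hence a
  subgroup, and a countable intersection of open sets is open here.\<close>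

lemma open_subgroup_nhd:
  assumes "openin T U" "\<one> \<in> U"
  obtains N where "subgroup N G" "openin T N" "N \<subseteq> U"
proof -
  have "\<exists>V. \<forall>n::nat. (openin T (V n) \<and> \<one> \<in> V n \<and> V n \<subseteq> U) \<and>
      (\<forall>x \<in> V (Suc n). \<forall>y \<in> V (Suc n). x \<otimes> inv y \<in> V n)"
  proof (rule dependent_nat_choice)
    show "\<exists>V. openin T V \<and> \<one> \<in> V \<and> V \<subseteq> U"
      using assms by blast
    fix V and n :: nat
    assume V: "openin T V \<and> \<one> \<in> V \<and> V \<subseteq> U"
    then obtain W where W: "openin T W" "\<one> \<in> W" "\<And>x y. x \<in> W \<Longrightarrow> y \<in> W \<Longrightarrow> x \<otimes> inv y \<in> V"
      using division_nhd by metis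
    then show "\<exists>W. (openin T W \<and> \<one> \<in> W \<and> W \<subseteq> U) \<and> (\<forall>x\<in>W. \<forall>y\<in>W. x \<otimes> inv y \<in> V)"
      using V by (intro exI[of _ "W \<inter> V"]) auto
  qed
  then obtain V :: "nat \<Rightarrow> 'a set" where *: "\<forall>n. (openin T (V n) \<and> \<one> \<in> V n \<and> V n \<subseteq> U) \<and>
      (\<forall>x \<in> V (Suc n). \<forall>y \<in> V (Suc n). x \<otimes> inv y \<in> V n)"
    by (rule exE)
  have V: "openin T (V n)" "\<one> \<in> V n" "V n \<subseteq> U"
    "x \<in> V (Suc n) \<Longrightarrow> y \<in> V (Suc n) \<Longrightarrow> x \<otimes> inv y \<in> V n" for n x y
    using spec[OF *, of n] by auto
  let ?N = "\<Inter>n. V n"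
  have sub: "?N \<subseteq> carrier G"
    using V(1) openin_carrier by blast
  have div: "x \<otimes> inv y \<in> ?N" if "x \<in> ?N" "y \<in> ?N" for x y
    using that V(4) by blast
  have one: "\<one> \<in> ?N"
    using V by blast
  have inv: "inv x \<in> ?N" if "x \<in> ?N" for x
    using div[OF one that] that sub by auto
  have "subgroup ?N G"
  proof (rule subgroupI)
    show "x \<otimes> y \<in> ?N" if "x \<in> ?N" "y \<in> ?N" for x y
      using div[OF that(1) inv[OF that(2)]] that sub by (simp add: subset_iff)
  qed (use one sub inv in auto)
  moreover have "openin T ?N"
    using V openin_INT_nat by blast
  ultimately show thesis
    using that V(3) by blast
qed

end

section \<open>Extension of characters\<close>

lemma hom_circle_group_iff:
  "f \<in> hom G circle_group \<longleftrightarrow>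
    (\<forall>x\<in>carrier G. norm (f x) = 1) \<and>
    (\<forall>x\<in>carrier G. \<forall>y\<in>carrier G. f (x \<otimes>\<^bsub>G\<^esub> y) = f x * f y)"
  by (auto simp: hom_def circle_group_def Pi_iff)

text \<open>There are \<open>m \<ge> 2\<close> distinct roots, so one differs from 1: a primitive
  root of unity if \<open>z = 1\<close>, and any root otherwise. This is what lets an extension be
  nontrivial at a prescribed point.\<close>

lemma exists_nontrivial_root:
  fixes z :: complex
  assumes "norm z = 1" "2 \<le> m"
  obtains w where "norm w = 1" "w ^ m = z" "w \<noteq> 1"
proof (cases "z = 1")
  case True
  let ?w = "cis (2 * pi / m)"
  have "?w ^ m = 1"
    using Complex.DeMoivre[of "2 * pi / m" m] assms by simp
  moreover have "?w \<noteq> 1"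
  proof
    assume "?w = 1"
    then have "cos (2 * pi / m) = 1"
      by (simp add: complex_eq_iff)
    then obtain n :: int where "2 * pi / m = of_int n * 2 * pi"
      using cos_one_2pi_int by blast
    then have "(1::real) = of_int (n * int m)"
      using assms by (simp add: field_simps)
    then have "1 = n * int m"
      by linarith
    with \<open>2 \<le> m\<close> show False
      using zmult_eq_1_iff[of n "int m"] by auto
  qed
  ultimately show thesis
    using True by (intro that[of ?w]) auto
next
  case False
  let ?w = "cis (Arg z / m)"
  have "z \<noteq> 0"
    using assms by auto
  then have "?w ^ m = z"
    using Complex.DeMoivre[of "Arg z / m" m] assms cis_Arg[of z] by (auto simp: sgn_eq)
  moreover have "?w \<noteq> 1"
    using False \<open>?w ^ m = z\<close> by (metis power_one)
  ultimately show thesis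
    by (intro that[of ?w]) auto
qed

text \<open>A character of a subgroup, encoded as its graph: a subgroup of the product of
  \<open>G\<close> with the circle whose fibre over the identity is trivial. For graphs, adjoining
  an element and taking unions of chains are plain set operations.\<close>

definition partial_character :: "('a, 'm) monoid_scheme \<Rightarrow> ('a \<times> complex) set \<Rightarrow> bool" where
  "partial_character G R \<longleftrightarrow>
     R \<subseteq> carrier G \<times> sphere 0 1 \<and> (\<one>\<^bsub>G\<^esub>, 1) \<in> R \<and>
     (\<forall>x z y w. (x, z) \<in> R \<longrightarrow> (y, w) \<in> R \<longrightarrow> (x \<otimes>\<^bsub>G\<^esub> y, z * w) \<in> R) \<and>
     (\<forall>x z. (x, z) \<in> R \<longrightarrow> (inv\<^bsub>G\<^esub> x, inverse z) \<in> R) \<and>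
     (\<forall>z. (\<one>\<^bsub>G\<^esub>, z) \<in> R \<longrightarrow> z = 1)"

context comm_group
begin

lemma partial_characterD:
  assumes "partial_character G R"
  shows "R \<subseteq> carrier G \<times> sphere 0 1" "(\<one>, 1) \<in> R"
    "(x, z) \<in> R \<Longrightarrow> (y, w) \<in> R \<Longrightarrow> (x \<otimes> y, z * w) \<in> R"
    "(x, z) \<in> R \<Longrightarrow> (inv x, inverse z) \<in> R"
    "(\<one>, z) \<in> R \<Longrightarrow> z = 1"
    "(x, z) \<in> R \<Longrightarrow> x \<in> carrier G" "(x, z) \<in> R \<Longrightarrow> norm z = 1"
  using assms by (auto simp: partial_character_def)

lemma partial_character_unique:
  assumes "partial_character G R" "(x, z) \<in> R" "(x, w) \<in> R"
  shows "z = w"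
proof -
  have "(x \<otimes> inv x, z * inverse w) \<in> R"
    using partial_characterD(3)[OF assms(1,2) partial_characterD(4)[OF assms(1,3)]] .
  moreover have "x \<in> carrier G" "w \<noteq> 0"
    using partial_characterD(6,7)[OF assms(1,3)] by auto
  ultimately show ?thesis
    using partial_characterD(5)[OF assms(1), of "z * inverse w"] by (simp add: field_simps)
qed

lemma partial_character_int_pow:
  assumes R: "partial_character G R" and xz: "(x, z) \<in> R"
  shows "(x [^] (k::int), z powi k) \<in> R"
proof -
  have nat: "(x [^] n, z ^ n) \<in> R" for n :: nat
  proof (induction n)
    case 0
    then show ?case
      using partial_characterD(2)[OF R] by simp
  next
    case (Suc n)
    then show ?case
      using partial_characterD(3)[OF R _ xz, of "x [^] n" "z ^ n"] by (simp add: mult.commute)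
  qed
  have "x \<in> carrier G"
    using partial_characterD(6)[OF R xz] .
  then show ?thesis
  proof (cases k rule: int_cases2)
    case (nonneg n)
    then show ?thesis
      using nat[of n] by (simp add: int_pow_int)
  next
    case (nonpos n)
    then show ?thesis
      using partial_characterD(4)[OF R nat[of n]] \<open>x \<in> carrier G\<close>
      by (simp add: int_pow_neg_int power_int_minus)
  qed
qed

text \<open>The consistency condition for sending \<open>x\<close> to \<open>w\<close>: it
  constrains \<open>w\<close> only through those powers of \<open>x\<close> that already have a
  value.\<close>

definition compatible_value :: "('a \<times> complex) set \<Rightarrow> 'a \<Rightarrow> complex \<Rightarrow> bool" where
  "compatible_value R x w \<longleftrightarrow>
     norm w = 1 \<and> (\<forall>(k::int) z. (x [^] k, z) \<in> R \<longrightarrow> z = w powi k)"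

text \<open>The graph grows to the subgroup generated by it and \<open>(x, w)\<close>. The fibre
  over the identity stays trivial: if \<open>y x^k\<close> is the identity, then
  \<open>y = x^(-k)\<close> is in the old domain, where compatibility prescribes its value.\<close>

lemma partial_character_adjoin:
  assumes R: "partial_character G R" and x: "x \<in> carrier G" and w: "compatible_value R x w"
  obtains R' where "partial_character G R'" "R \<subseteq> R'" "(x, w) \<in> R'"
proof
  note D = partial_characterD[OF R]
  have nw: "norm w = 1" "w \<noteq> 0" and wk: "\<And>k z. (x [^] (k::int), z) \<in> R \<Longrightarrow> z = w powi k"
    using w by (auto simp: compatible_value_def)
  let ?R = "{(y \<otimes> x [^] (k::int), z * w powi k) | y z k. (y, z) \<in> R}"
  show "R \<subseteq> ?R"
  proof (rule subrelI)
    fix y z assume yz: "(y, z) \<in> R"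
    then have "(y \<otimes> x [^] (0::int), z * w powi 0) \<in> ?R"
      by blast
    then show "(y, z) \<in> ?R"
      using D(6)[OF yz] by simp
  qed
  show "(x, w) \<in> ?R"
  proof -
    have "(\<one> \<otimes> x [^] (1::int), 1 * w powi 1) \<in> ?R"
      using D(2) by blast
    then show ?thesis
      using x by simp
  qed
  show "partial_character G ?R"
    unfolding partial_character_def
  proof (intro conjI allI impI)
    show "?R \<subseteq> carrier G \<times> sphere 0 1"
      using D(6,7) x nw by (auto simp: norm_mult norm_power_int)
    show "(\<one>, 1) \<in> ?R"
      using \<open>R \<subseteq> ?R\<close> D(2) by blast
  next
    fix a b c d assume "(a, b) \<in> ?R" "(c, d) \<in> ?R"
    then obtain y z k y' z' l where *: "a = y \<otimes> x [^] (k::int)" "b = z * w powi k" "(y, z) \<in> R"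
      "c = y' \<otimes> x [^] (l::int)" "d = z' * w powi l" "(y', z') \<in> R"
      by blast
    then have "a \<otimes> c = (y \<otimes> y') \<otimes> x [^] (k + l)"
      using D(6) x by (simp add: int_pow_mult m_ac)
    moreover have "b * d = (z * z') * w powi (k + l)"
      using * nw by (simp add: power_int_add)
    ultimately show "(a \<otimes> c, b * d) \<in> ?R"
      using D(3)[of y z y' z'] * by blast
  next
    fix a b assume "(a, b) \<in> ?R"
    then obtain y z k where *: "a = y \<otimes> x [^] (k::int)" "b = z * w powi k" "(y, z) \<in> R"
      by blast
    then have "inv a = inv y \<otimes> x [^] (- k)"
      using D(6) x by (simp add: int_pow_neg inv_mult)
    moreover have "inverse b = inverse z * w powi (- k)"
      using * by (simp add: power_int_minus)
    ultimately show "(inv a, inverse b) \<in> ?R"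
      using D(4)[of y z] * by blast
  next
    fix b assume "(\<one>, b) \<in> ?R"
    then obtain y z k where *: "\<one> = y \<otimes> x [^] (k::int)" "b = z * w powi k" "(y, z) \<in> R"
      by blast
    then have "y = x [^] (- k)"
      using D(6) x by (simp add: int_pow_neg inv_equality)
    then have "z = w powi (- k)"
      using wk * by blast
    then show "b = 1"
      using * nw by (simp add: power_int_minus)
  qed
qed

text \<open>If no positive power of \<open>x\<close> has a value, every unimodular \<open>w\<close>
  is compatible and \<open>- 1\<close> is a nontrivial choice. Otherwise the least exponent
  \<open>m\<close> with a value is at least 2, as \<open>x\<close> itself has none, and a nontrivial
  \<open>m\<close>-th root of the value at \<open>x^m\<close> serves.\<close>

lemma exists_nontrivial_compatible_value:
  assumes R: "partial_character G R" and x: "x \<in> carrier G" "x \<notin> Domain R"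
  obtains w where "compatible_value R x w" "w \<noteq> 1"
proof (cases "\<exists>m::nat. 0 < m \<and> x [^] m \<in> Domain R")
  case False
  note D = partial_characterD[OF R]
  have "z = (- 1) powi k" if "(x [^] (k::int), z) \<in> R" for k z
  proof (cases k rule: int_cases3)
    case zero
    with that D(5) show ?thesis by simp
  next
    case (pos n)
    with that have "x [^] n \<in> Domain R" by (auto simp: int_pow_int)
    with False pos show ?thesis by blast
  next
    case (neg n)
    with D(4)[OF that] x have "x [^] n \<in> Domain R" by (auto simp: int_pow_neg_int)
    with False neg show ?thesis by blast
  qed
  then show thesis
    by (intro that[of "- 1"]) (auto simp: compatible_value_def)
next
  case True
  note D = partial_characterD[OF R]
  define m where "m = (LEAST m::nat. 0 < m \<and> x [^] m \<in> Domain R)"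
  have m: "0 < m" "x [^] m \<in> Domain R"
    using LeastI_ex[OF True] by (auto simp: m_def)
  have least: "m \<le> n" if "0 < n" "x [^] n \<in> Domain R" for n :: nat
    using that by (auto simp: m_def intro: Least_le)
  have "m \<noteq> 1"
    using m x by auto
  with m have "2 \<le> m"
    by simp
  obtain u where u: "(x [^] m, u) \<in> R"
    using m by auto
  then obtain w where w: "norm w = 1" "w ^ m = u" "w \<noteq> 1"
    using exists_nontrivial_root \<open>2 \<le> m\<close> D(7) by metis
  have "z = w powi k" if k: "(x [^] (k::int), z) \<in> R" for k z
  proof -
    have pow: "(x [^] (int m * j), u powi j) \<in> R" for j
      using partial_character_int_pow[OF R u, of j] x by (simp add: int_pow_pow flip: int_pow_int)
    \<comment> \<open>Dividing \<open>x^k\<close> by a power of \<open>x^m\<close> leaves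
      \<open>x^(k mod m)\<close> in the domain. Minimality of \<open>m\<close> forces the remainder
      to be 0, so only multiples of \<open>m\<close> occur as exponents.\<close>
    let ?r = "nat (k mod int m)"
    have "(x [^] (k + int m * - (k div int m)), z * u powi (- (k div int m))) \<in> R"
      using D(3)[OF k pow] x by (simp only: int_pow_mult)
    moreover have "k + int m * - (k div int m) = int ?r"
      using m by (simp add: minus_mult_div_eq_mod)
    ultimately have "x [^] ?r \<in> Domain R"
      by (simp only: int_pow_int Domain.simps) blast
    moreover have "?r < m"
      using m by (simp add: nat_less_iff)
    ultimately have "?r = 0"
      using least[of ?r] by (cases "?r = 0") auto
    moreover have "0 \<le> k mod int m"
      using m by simp
    ultimately have "k mod int m = 0"
      by linarith
    then have "k = int m * (k div int m)"
      by auto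
    then obtain j where j: "k = int m * j"
      by blast
    have "z = u powi j"
      using partial_character_unique[OF R k] pow[of j] j by simp
    also have "\<dots> = w powi k"
      using w j by (simp add: power_int_mult)
    finally show ?thesis .
  qed
  then show thesis
    using w by (intro that[of w]) (auto simp: compatible_value_def)
qed

text \<open>A maximal graph is total, since any missing point has a compatible value and could be
  adjoined. Divisibility of the circle enters through the roots behind that value.\<close>

lemma partial_character_extends:
  assumes R: "partial_character G R"
  obtains \<phi> where "\<phi> \<in> hom G circle_group" "\<And>y z. (y, z) \<in> R \<Longrightarrow> \<phi> y = z"
proof -
  let ?A = "{S. partial_character G S \<and> R \<subseteq> S}"
  have "\<exists>M\<in>?A. \<forall>X\<in>?A. M \<subseteq> X \<longrightarrow> X = M"
  proof (rule subset_Zorn_nonempty)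
    fix \<C> assume "\<C> \<noteq> {}" and "subset.chain ?A \<C>"
    then have C: "\<And>S. S \<in> \<C> \<Longrightarrow> partial_character G S" "\<And>S. S \<in> \<C> \<Longrightarrow> R \<subseteq> S"
      and ch: "\<And>S S'. S \<in> \<C> \<Longrightarrow> S' \<in> \<C> \<Longrightarrow> S \<subseteq> S' \<or> S' \<subseteq> S"
      by (auto simp: subset_chain_def)
    note D = partial_characterD[OF C(1)]
    have "partial_character G (\<Union>\<C>)"
      unfolding partial_character_def
    proof (intro conjI allI impI)
      show "\<Union>\<C> \<subseteq> carrier G \<times> sphere 0 1"
        using C(1) partial_characterD(1) by blast
      show "(\<one>, 1) \<in> \<Union>\<C>"
        using D(2) \<open>\<C> \<noteq> {}\<close> by blast
      show "z = 1" if "(\<one>, z) \<in> \<Union>\<C>" for z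
        using D(5) that by blast
      show "(inv x, inverse z) \<in> \<Union>\<C>" if "(x, z) \<in> \<Union>\<C>" for x z
        using D(4) that by blast
      fix x z y w assume "(x, z) \<in> \<Union>\<C>" "(y, w) \<in> \<Union>\<C>"
      then obtain S where "S \<in> \<C>" "(x, z) \<in> S" "(y, w) \<in> S"
        using ch by blast
      then show "(x \<otimes> y, z * w) \<in> \<Union>\<C>"
        using D(3) by blast
    qed
    then show "\<Union>\<C> \<in> ?A"
      using C(2) \<open>\<C> \<noteq> {}\<close> by blast
  qed (use R in auto)
  then obtain M where M: "partial_character G M" "R \<subseteq> M"
    and max: "\<And>S. partial_character G S \<Longrightarrow> M \<subseteq> S \<Longrightarrow> S = M"
    by auto
  have "\<exists>z. (x, z) \<in> M" if x: "x \<in> carrier G" for x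
  proof (rule ccontr)
    assume "\<nexists>z. (x, z) \<in> M"
    then have nx: "x \<notin> Domain M"
      by blast
    obtain w where "compatible_value M x w"
      using exists_nontrivial_compatible_value[OF M(1) x nx] by blast
    then obtain S where "partial_character G S" "M \<subseteq> S" "(x, w) \<in> S"
      using partial_character_adjoin[OF M(1) x] by blast
    with max nx show False
      by blast
  qed
  then have "\<forall>x\<in>carrier G. \<exists>z. (x, z) \<in> M"
    by blast
  then obtain \<phi> where "\<forall>x\<in>carrier G. (x, \<phi> x) \<in> M"
    by (rule bchoice[THEN exE])
  then have \<phi>: "(x, \<phi> x) \<in> M" if "x \<in> carrier G" for x
    using that by blast
  note D = partial_characterD[OF M(1)]
  have unique: "\<phi> x = z" if "(x, z) \<in> M" for x z
    using partial_character_unique[OF M(1) \<phi> that] D(6)[OF that] by blast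
  have "\<phi> \<in> hom G circle_group"
    unfolding hom_circle_group_iff
  proof (intro conjI ballI)
    show "norm (\<phi> x) = 1" if "x \<in> carrier G" for x
      using D(7)[OF \<phi>[OF that]] .
    show "\<phi> (x \<otimes> y) = \<phi> x * \<phi> y" if "x \<in> carrier G" "y \<in> carrier G" for x y
      using unique[OF D(3)[OF \<phi>[OF that(1)] \<phi>[OF that(2)]]] .
  qed
  then show thesis
    using that unique M(2) by blast
qed

text \<open>The trivial character of \<open>N\<close> is given a value other than 1 at
  \<open>x\<close> before it is extended to all of \<open>G\<close>.\<close>

lemma hom_circle_separates:
  assumes N: "subgroup N G" and x: "x \<in> carrier G" "x \<notin> N"
  obtains \<phi> where "\<phi> \<in> hom G circle_group" "\<And>y. y \<in> N \<Longrightarrow> \<phi> y = 1" "\<phi> x \<noteq> 1"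
proof -
  have R: "partial_character G (N \<times> {1})"
    using N subgroup.subset[OF N]
    by (auto simp: partial_character_def subgroup.one_closed subgroup.m_closed subgroup.m_inv_closed)
  have "x \<notin> Domain (N \<times> {1::complex})"
    using x by blast
  then obtain w where w: "compatible_value (N \<times> {1}) x w" "w \<noteq> 1"
    using exists_nontrivial_compatible_value R x by blast
  obtain R' where R': "partial_character G R'" "N \<times> {1} \<subseteq> R'" "(x, w) \<in> R'"
    using partial_character_adjoin R x w by blast
  obtain \<phi> where "\<phi> \<in> hom G circle_group" "\<And>y z. (y, z) \<in> R' \<Longrightarrow> \<phi> y = z"
    using partial_character_extends R' by blast
  then show thesis
    using that R' w by blast
qed

end

text \<open>While \<open>w\<close> is within distance 1 of 1, its real part exceeds 1/2, so
  \<open>|w + 1| \<ge> 3/2\<close> and squaring multiplies the distance to 1 by at least 3/2.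
  Repeated squaring must therefore leave the disc.\<close>

lemma no_small_subgroup_circle:
  fixes z :: complex
  assumes "norm z = 1" "z \<noteq> 1"
  obtains n :: nat where "1 \<le> dist (z ^ n) 1"
proof -
  have step: "3 / 2 * dist w 1 \<le> dist (w\<^sup>2) 1" if "norm w = 1" "dist w 1 < 1" for w :: complex
  proof -
    have "(Re w)\<^sup>2 + (Im w)\<^sup>2 = 1"
      using that(1) by (simp flip: cmod_power2)
    then have "(norm (w - 1))\<^sup>2 = 2 - 2 * Re w"
      unfolding cmod_power2 by (simp add: power2_eq_square algebra_simps)
    moreover have "(norm (w - 1))\<^sup>2 < 1"
      using that(2) by (simp add: dist_norm power_less_one_iff)
    ultimately have "3 / 2 \<le> Re (w + 1)"
      by simp
    also have "\<dots> \<le> norm (w + 1)"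
      by (rule complex_Re_le_cmod)
    finally have "3 / 2 * norm (w - 1) \<le> norm (w + 1) * norm (w - 1)"
      by (rule mult_right_mono) simp
    also have "\<dots> = norm (w\<^sup>2 - 1)"
      by (simp add: power2_eq_square algebra_simps flip: norm_mult)
    finally show ?thesis
      by (simp add: dist_norm)
  qed
  have "\<exists>n. 1 \<le> dist (z ^ n) 1"
  proof (rule ccontr)
    assume "\<nexists>n. 1 \<le> dist (z ^ n) 1"
    then have small: "dist (z ^ n) 1 < 1" for n
      by (simp add: not_le)
    have "(3 / 2) ^ k * dist z 1 \<le> dist (z ^ (2 ^ k)) 1" for k
    proof (induction k)
      case (Suc k)
      then have "(3 / 2) ^ Suc k * dist z 1 \<le> 3 / 2 * dist (z ^ (2 ^ k)) 1"
        by (simp add: mult_ac)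
      also have "\<dots> \<le> dist ((z ^ (2 ^ k))\<^sup>2) 1"
        using assms by (intro step small) (simp add: norm_power)
      also have "(z ^ (2 ^ k))\<^sup>2 = z ^ (2 ^ Suc k)"
        by (simp add: mult.commute flip: power_mult)
      finally show ?case .
    qed simp
    then have "(3 / 2) ^ k * dist z 1 < 1" for k
      using small by (rule order_le_less_trans)
    then have bound: "(3 / 2) ^ k < 1 / dist z 1" for k
      using assms by (simp add: field_simps)
    moreover obtain k where "1 / dist z 1 < (3 / 2) ^ k"
      using real_arch_pow[of "3 / 2" "1 / dist z 1"] by auto
    ultimately show False
      using less_asym by blast
  qed
  then show thesis
    using that by blast
qed

section \<open>The dual group and annihilators\<close>

lemma continuous_map_mult:
  fixes f g :: "'a \<Rightarrow> 'b :: real_normed_algebra"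
  assumes "continuous_map X euclidean f" "continuous_map X euclidean g"
  shows "continuous_map X euclidean (\<lambda>x. f x * g x)"
proof -
  have "continuous_map X (prod_topology euclidean euclidean) (\<lambda>x. (f x, g x))"
    using assms by (simp only: continuous_map_pairwise o_def fst_conv snd_conv)
  then have "continuous_map X euclidean (\<lambda>x. (f x, g x))"
    by simp
  moreover have "continuous_map euclidean euclidean (\<lambda>p :: 'b \<times> 'b. fst p * snd p)"
    by (simp add: continuous_on_mult continuous_on_fst continuous_on_snd)
  ultimately have "continuous_map X euclidean ((\<lambda>p. fst p * snd p) \<circ> (\<lambda>x. (f x, g x)))"
    by (rule continuous_map_compose)
  then show ?thesis
    by (simp add: o_def)
qed

lemma cnj_mult_self_eq_1: "norm z = 1 \<Longrightarrow> cnj z * z = 1"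
  by (simp add: mult.commute flip: complex_norm_square)

lemma mem_characters_iff:
  "\<phi> \<in> characters G T \<longleftrightarrow>
    \<phi> \<in> hom G circle_group \<and> \<phi> \<in> extensional (carrier G) \<and> continuous_map T euclidean \<phi> \<and>
    topspace T \<subseteq> {x. norm (\<phi> x) = 1}"
  by (auto simp: characters_def continuous_map_in_subtopology)

definition annihilator :: "('a, 'm) monoid_scheme \<Rightarrow> 'a topology \<Rightarrow> 'a set \<Rightarrow> ('a \<Rightarrow> complex) set" where
  "annihilator G T N = {\<phi> \<in> characters G T. \<forall>x\<in>N. \<phi> x = 1}"

lemma dual_group_simps [simp]:
  "carrier (dual_group G T) = characters G T"
  "\<phi> \<otimes>\<^bsub>dual_group G T\<^esub> \<psi> = (\<lambda>x\<in>carrier G. \<phi> x * \<psi> x)"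
  "\<one>\<^bsub>dual_group G T\<^esub> = (\<lambda>x\<in>carrier G. 1)"
  by (simp_all add: dual_group_def)

section \<open>The group of characters and the evaluation homomorphism\<close>

context topological_ab_group
begin

lemma characterI:
  assumes "\<phi> \<in> hom G circle_group" "\<phi> \<in> extensional (carrier G)" "continuous_map T euclidean \<phi>"
  shows "\<phi> \<in> characters G T"
  using assms by (auto simp: mem_characters_iff hom_circle_group_iff topspace_eq)

lemma characterD:
  assumes "\<phi> \<in> characters G T"
  shows "x \<in> carrier G \<Longrightarrow> norm (\<phi> x) = 1"
    "x \<in> carrier G \<Longrightarrow> y \<in> carrier G \<Longrightarrow> \<phi> (x \<otimes> y) = \<phi> x * \<phi> y"
    "\<phi> \<in> extensional (carrier G)"
    "continuous_map T euclidean \<phi>"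
  using assms by (auto simp: mem_characters_iff hom_circle_group_iff)

lemma character_one:
  assumes "\<phi> \<in> characters G T"
  shows "\<phi> \<one> = 1"
  using characterD(1)[OF assms, of \<one>] characterD(2)[OF assms, of \<one> \<one>] by auto

lemma character_inv:
  assumes "\<phi> \<in> characters G T" "x \<in> carrier G"
  shows "\<phi> (inv x) = cnj (\<phi> x)"
proof -
  have "\<phi> (inv x) * \<phi> x = 1"
    using characterD(2)[OF assms(1), of "inv x" x] assms(2) character_one[OF assms(1)] by simp
  moreover have "cnj (\<phi> x) * \<phi> x = 1"
    using characterD(1)[OF assms] by (rule cnj_mult_self_eq_1)
  ultimately show ?thesis
    by (metis mult_cancel_right mult_zero_right zero_neq_one)
qed

lemma character_mult:
  assumes "\<phi> \<in> characters G T" "\<psi> \<in> characters G T"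
  shows "(\<lambda>x\<in>carrier G. \<phi> x * \<psi> x) \<in> characters G T"
proof (rule characterI)
  have "continuous_map T euclidean (\<lambda>x. \<phi> x * \<psi> x)"
    using assms characterD(4) by (intro continuous_map_mult)
  then show "continuous_map T euclidean (\<lambda>x\<in>carrier G. \<phi> x * \<psi> x)"
    by (rule continuous_map_eq) (simp add: topspace_eq)
qed (use assms in \<open>auto simp: hom_circle_group_iff characterD norm_mult\<close>)

lemma trivial_character: "(\<lambda>x\<in>carrier G. 1) \<in> characters G T"
proof (rule characterI)
  have "continuous_map T euclidean (\<lambda>x. 1 :: complex)"
    by simp
  then show "continuous_map T euclidean (\<lambda>x\<in>carrier G. 1 :: complex)"
    by (rule continuous_map_eq) (simp add: topspace_eq)
qed (auto simp: hom_circle_group_iff)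

lemma character_cnj:
  assumes "\<phi> \<in> characters G T"
  shows "(\<lambda>x\<in>carrier G. cnj (\<phi> x)) \<in> characters G T"
proof (rule characterI)
  have "continuous_map T euclidean (cnj \<circ> \<phi>)"
    using characterD(4)[OF assms] by (rule continuous_map_compose) (simp add: continuous_on_cnj)
  then show "continuous_map T euclidean (\<lambda>x\<in>carrier G. cnj (\<phi> x))"
    by (rule continuous_map_eq) (simp add: topspace_eq)
qed (use assms in \<open>auto simp: hom_circle_group_iff characterD\<close>)

lemma comm_group_dual: "comm_group (dual_group G T)"
proof (rule comm_groupI, goal_cases)
  \<comment> \<open>The sixth goal is the existence of inverses; conjugation inverts unimodular
    values.\<close>
  case (6 \<phi>)
  moreover have "(\<lambda>x\<in>carrier G. cnj (\<phi> x) * \<phi> x) = (\<lambda>x\<in>carrier G. 1)"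
    using 6 characterD(1) by (intro restrict_ext cnj_mult_self_eq_1) auto
  ultimately show ?case
    using character_cnj[of \<phi>] by (intro bexI[of _ "\<lambda>x\<in>carrier G. cnj (\<phi> x)"]) (auto cong: restrict_cong)
qed (auto simp: character_mult trivial_character characterD(3) mult_ac extensional_restrict
      intro!: restrict_ext intro: extensionalityI[of _ "carrier G"] cong: restrict_cong)

lemma dual_inv:
  assumes "\<phi> \<in> characters G T"
  shows "inv\<^bsub>dual_group G T\<^esub> \<phi> = (\<lambda>x\<in>carrier G. cnj (\<phi> x))"
proof (rule group.inv_equality)
  show "group (dual_group G T)"
    using comm_group_dual comm_group.axioms by blast
  show "(\<lambda>x\<in>carrier G. cnj (\<phi> x)) \<otimes>\<^bsub>dual_group G T\<^esub> \<phi> = \<one>\<^bsub>dual_group G T\<^esub>"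
    using characterD(1)[OF assms] by (auto simp: restrict_def fun_eq_iff cnj_mult_self_eq_1)
qed (use assms character_cnj in auto)

text \<open>Singletons are compact, so closeness at \<open>x\<close> alone already defines a
  neighbourhood in the dual topology.\<close>

lemma evaluation_mem_characters:
  assumes x: "x \<in> carrier G"
  shows "evaluation G T x \<in> characters (dual_group G T) (dual_topology G T)"
  unfolding mem_characters_iff topspace_dual_topology
proof (intro conjI)
  show "evaluation G T x \<in> hom (dual_group G T) circle_group"
    using x by (auto simp: hom_circle_group_iff evaluation_def characterD character_mult)
  show "evaluation G T x \<in> extensional (carrier (dual_group G T))"
    by (simp add: evaluation_def)
  show "characters G T \<subseteq> {\<phi>. norm (evaluation G T x \<phi>) = 1}"
    using x by (auto simp: evaluation_def characterD)
  show "continuous_map (dual_topology G T) euclidean (evaluation G T x)"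
    unfolding continuous_map_def topspace_dual_topology
  proof (intro conjI allI impI)
    fix U :: "complex set" assume "openin euclidean U"
    then have U: "open U"
      by simp
    show "openin (dual_topology G T) {\<phi> \<in> characters G T. evaluation G T x \<phi> \<in> U}"
      unfolding openin_dual_topology
    proof (intro conjI ballI)
      fix \<phi> assume "\<phi> \<in> {\<phi> \<in> characters G T. evaluation G T x \<phi> \<in> U}"
      then have "\<phi> x \<in> U"
        by (auto simp: evaluation_def)
      then obtain e where "0 < e" "\<forall>z. dist z (\<phi> x) < e \<longrightarrow> z \<in> U"
        using U by (auto simp: open_dist)
      then show "\<exists>C e. compactin T C \<and> 0 < e \<and>
          {\<psi> \<in> characters G T. \<forall>x\<in>C. dist (\<psi> x) (\<phi> x) < e}
          \<subseteq> {\<phi> \<in> characters G T. evaluation G T x \<phi> \<in> U}"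
        using x by (intro exI[of _ "{x}"] exI[of _ e]) (auto simp: evaluation_def topspace_eq)
    qed auto
  qed auto
qed

lemma evaluation_hom: "evaluation G T \<in> hom G (bidual_group G T)"
proof (rule homI)
  show "evaluation G T x \<in> carrier (bidual_group G T)" if "x \<in> carrier G" for x
    using evaluation_mem_characters[OF that] by simp
  show "evaluation G T (x \<otimes> y) = evaluation G T x \<otimes>\<^bsub>bidual_group G T\<^esub> evaluation G T y"
    if "x \<in> carrier G" "y \<in> carrier G" for x y
    using that by (auto simp: evaluation_def restrict_def fun_eq_iff characterD)
qed

text \<open>Such a \<phi> is constant on each translate of \<open>N\<close>, so the preimage of any
  set of values is open.\<close>

lemma locally_constant_hom_continuous:
  assumes \<phi>: "\<phi> \<in> hom G circle_group" and N: "openin T N" "\<one> \<in> N" "\<And>y. y \<in> N \<Longrightarrow> \<phi> y = 1"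
  shows "continuous_map T euclidean \<phi>"
  unfolding continuous_map_def topspace_eq
proof (intro conjI allI impI)
  fix U :: "complex set"
  show "openin T {x \<in> carrier G. \<phi> x \<in> U}"
  proof (subst openin_subopen, intro ballI)
    fix x assume x: "x \<in> {x \<in> carrier G. \<phi> x \<in> U}"
    let ?V = "{y \<in> carrier G. inv x \<otimes> y \<in> N}"
    have "openin T ?V"
      using x N openin_translation by simp
    moreover have "x \<in> ?V"
      using x N by simp
    moreover have "\<phi> y = \<phi> x" if "y \<in> ?V" for y
    proof -
      have "\<phi> (x \<otimes> (inv x \<otimes> y)) = \<phi> x * \<phi> (inv x \<otimes> y)"
        using \<phi> x that by (simp add: hom_circle_group_iff)
      then show ?thesis
        using x that N(3) by (simp flip: m_assoc)
    qed
    moreover from this have "?V \<subseteq> {x \<in> carrier G. \<phi> x \<in> U}"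
      using x by auto
    ultimately show "\<exists>V. openin T V \<and> x \<in> V \<and> V \<subseteq> {x \<in> carrier G. \<phi> x \<in> U}"
      by meson
  qed
qed auto

text \<open>Supplies the powers of \<phi> among which \<open>annihilator_separates\<close> finds one
  that sends \<open>x\<close> far from 1.\<close>

lemma annihilator_closed_under_powers:
  assumes "\<phi> \<in> annihilator G T N" "N \<subseteq> carrier G"
  shows "(\<lambda>x\<in>carrier G. \<phi> x ^ n) \<in> annihilator G T N"
proof (induction n)
  case 0
  have "(\<lambda>x\<in>carrier G. \<phi> x ^ 0) \<in> characters G T"
    by (simp only: power_0 trivial_character)
  moreover have "\<forall>x\<in>N. (\<lambda>x\<in>carrier G. \<phi> x ^ 0) x = 1"
    using assms(2) by auto
  ultimately show ?case
    unfolding annihilator_def by blast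
next
  case (Suc n)
  have "(\<lambda>x\<in>carrier G. \<phi> x * (\<lambda>x\<in>carrier G. \<phi> x ^ n) x) \<in> characters G T"
    using assms Suc by (intro character_mult) (auto simp: annihilator_def)
  moreover have "(\<lambda>x\<in>carrier G. \<phi> x * (\<lambda>x\<in>carrier G. \<phi> x ^ n) x) = (\<lambda>x\<in>carrier G. \<phi> x ^ Suc n)"
    by (rule restrict_ext) simp
  ultimately have "(\<lambda>x\<in>carrier G. \<phi> x ^ Suc n) \<in> characters G T"
    by (simp only:)
  moreover have "\<forall>x\<in>N. (\<lambda>x\<in>carrier G. \<phi> x ^ Suc n) x = 1"
    using assms by (auto simp: annihilator_def)
  ultimately show ?case
    unfolding annihilator_def by blast
qed

text \<open>The circle has no small subgroups, so the bound 1 below is independent of \<open>x\<close> and \<open>N\<close>.\<close>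

lemma annihilator_separates:
  assumes N: "subgroup N G" "openin T N" and x: "x \<in> carrier G" "x \<notin> N"
  obtains \<phi> where "\<phi> \<in> annihilator G T N" "1 \<le> dist (\<phi> x) 1"
proof -
  obtain \<phi> where \<phi>: "\<phi> \<in> hom G circle_group" "\<And>y. y \<in> N \<Longrightarrow> \<phi> y = 1" "\<phi> x \<noteq> 1"
    using hom_circle_separates[OF N(1) x] by blast
  have "continuous_map T euclidean \<phi>"
    using \<phi> N subgroup.one_closed by (intro locally_constant_hom_continuous) auto
  then have "continuous_map T euclidean (restrict \<phi> (carrier G))"
    by (rule continuous_map_eq) (simp add: topspace_eq)
  moreover have "restrict \<phi> (carrier G) \<in> hom G circle_group"
    using \<phi>(1) by (simp add: hom_circle_group_iff)
  ultimately have "restrict \<phi> (carrier G) \<in> characters G T"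
    by (intro characterI) auto
  then have ann: "restrict \<phi> (carrier G) \<in> annihilator G T N"
    using \<phi>(2) subgroup.subset[OF N(1)] by (auto simp: annihilator_def)
  have "norm (\<phi> x) = 1"
    using \<phi>(1) x by (simp add: hom_circle_group_iff)
  then obtain n where n: "1 \<le> dist (\<phi> x ^ n) 1"
    using no_small_subgroup_circle \<phi>(3) by blast
  show thesis
    using annihilator_closed_under_powers[OF ann subgroup.subset[OF N(1)], of n]
    by (rule that) (use n x in simp)
qed

end

context P_ab_group
begin

text \<open>A multiplicative function that is 1 on the open set \<open>N\<close> is automatically
  continuous, so the annihilator is cut out of the product of circles by closed conditions. The
  product topology on it maps continuously to the dual topology because the compact subsets of
  \<open>G\<close> are finite.\<close>

lemma compactin_annihilator:
  assumes N: "subgroup N G" "openin T N"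
  shows "compactin (dual_topology G T) (annihilator G T N)"
proof -
  define P where "P = product_topology (\<lambda>_. top_of_set (sphere 0 1 :: complex set)) (carrier G)"
  have topP: "topspace P = (\<Pi>\<^sub>E x\<in>carrier G. sphere 0 1)"
    by (simp add: P_def)
  have proj: "continuous_map P euclidean (\<lambda>f. f x)" if "x \<in> carrier G" for x
    using continuous_map_product_projection[OF that, of "\<lambda>_. top_of_set (sphere 0 1 :: complex set)"]
    by (simp add: P_def continuous_map_in_subtopology)
  have cl1: "closedin P {f \<in> topspace P. f x = 1}" if "x \<in> carrier G" for x
    using closedin_continuous_map_preimage[OF proj[OF that], of "{1}"] by simp
  have cl2: "closedin P {f \<in> topspace P. f (x \<otimes> y) = f x * f y}"
    if "x \<in> carrier G" "y \<in> carrier G" for x y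
  proof -
    have "continuous_map P euclidean (\<lambda>f. f (x \<otimes> y) - f x * f y)"
      using that by (intro continuous_map_diff continuous_map_mult proj) auto
    from closedin_continuous_map_preimage[OF this, of "{0}"] show ?thesis
      by simp
  qed
  have ann: "annihilator G T N = topspace P \<inter> ((\<Inter>x\<in>N. {f \<in> topspace P. f x = 1}) \<inter>
     (\<Inter>x\<in>carrier G. \<Inter>y\<in>carrier G. {f \<in> topspace P. f (x \<otimes> y) = f x * f y}))" (is "_ = ?A")
  proof
    show "annihilator G T N \<subseteq> ?A"
      by (auto simp: annihilator_def topP characterD PiE_def)
    show "?A \<subseteq> annihilator G T N"
    proof
      fix f assume f: "f \<in> ?A"
      then have hom: "f \<in> hom G circle_group" "f \<in> extensional (carrier G)"
        and "\<And>x. x \<in> N \<Longrightarrow> f x = 1"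
        by (auto simp: topP hom_circle_group_iff PiE_def)
      then show "f \<in> annihilator G T N"
        using characterI[OF hom] locally_constant_hom_continuous[OF hom(1) N(2)] subgroup.one_closed[OF N(1)]
        by (auto simp: annihilator_def)
    qed
  qed
  have NG: "N \<subseteq> carrier G" "N \<noteq> {}" "carrier G \<noteq> {}"
    using subgroup.subset[OF N(1)] subgroup.one_closed[OF N(1)] by auto
  have "closedin P (annihilator G T N)"
    unfolding ann using NG
    by (intro closedin_Int closedin_topspace closedin_INT cl1 cl2) auto
  moreover have "compact_space P"
    by (auto simp: P_def compact_space_product_topology compact_space_subtopology)
  ultimately have comp: "compactin (subtopology P (annihilator G T N)) (annihilator G T N)"
    by (simp add: closedin_compact_space compactin_subtopology)
  have "continuous_map (subtopology P (annihilator G T N)) (dual_topology G T) (\<lambda>f. f)"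
    unfolding continuous_map_def
  proof (intro conjI allI impI)
    show "(\<lambda>f. f) \<in> topspace (subtopology P (annihilator G T N)) \<rightarrow> topspace (dual_topology G T)"
      by (auto simp: topspace_dual_topology annihilator_def)
    fix U assume U: "openin (dual_topology G T) U"
    show "openin (subtopology P (annihilator G T N))
       {f \<in> topspace (subtopology P (annihilator G T N)). f \<in> U}"
    proof (subst openin_subopen, intro ballI)
      fix \<phi> assume "\<phi> \<in> {f \<in> topspace (subtopology P (annihilator G T N)). f \<in> U}"
      then have \<phi>: "\<phi> \<in> annihilator G T N" "\<phi> \<in> topspace P" "\<phi> \<in> U"
        by auto
      then obtain C e where C: "compactin T C" "0 < e"
        "{\<psi> \<in> characters G T. \<forall>x\<in>C. dist (\<psi> x) (\<phi> x) < e} \<subseteq> U"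
        using U unfolding openin_dual_topology by blast
      have CG: "C \<subseteq> carrier G" "finite C"
        using compactin_subset_topspace[OF C(1)] compactin_finite[OF C(1)] topspace_eq by auto
      \<comment> \<open>Finiteness of \<open>C\<close> makes this set open in the product;
        intersecting with \<open>topspace P\<close> covers the case of empty
        \<open>C\<close>.\<close>
      let ?W = "topspace P \<inter> (\<Inter>x\<in>C. {f \<in> topspace P. f x \<in> ball (\<phi> x) e})"
      have op: "openin P {f \<in> topspace P. f x \<in> ball (\<phi> x) e}" if "x \<in> C" for x
      proof (rule openin_continuous_map_preimage[OF proj])
        show "x \<in> carrier G"
          using that CG by blast
      qed simp
      have "openin P ?W"
      proof (cases "C = {}")
        case False
        then show ?thesis
          using CG op by (intro openin_Int openin_topspace openin_Inter finite_imageI) blast+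
      qed auto
      then have "openin (subtopology P (annihilator G T N)) (?W \<inter> annihilator G T N)"
        by (auto simp: openin_subtopology)
      moreover have "\<phi> \<in> ?W \<inter> annihilator G T N"
        using \<phi> C by auto
      moreover have "?W \<inter> annihilator G T N \<subseteq> {f \<in> topspace (subtopology P (annihilator G T N)). f \<in> U}"
        using C(3) by (auto simp: annihilator_def dist_commute)
      ultimately show "\<exists>V. openin (subtopology P (annihilator G T N)) V \<and> \<phi> \<in> V \<and>
          V \<subseteq> {f \<in> topspace (subtopology P (annihilator G T N)). f \<in> U}"
        by blast
    qed
  qed
  from image_compactin[OF comp this] show ?thesis
    by simp
qed

end

section \<open>Characters of the dual group\<close>

text \<open>The bound is independent of the number of terms, so averages of many powers of a
  nontrivial unimodular number are small.\<close>

lemma norm_sum_powers_le: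
  fixes z :: complex
  assumes "norm z = 1" "z \<noteq> 1"
  shows "norm (\<Sum>k<N. z ^ k) \<le> 2 / norm (z - 1)"
proof -
  have "norm (z ^ N - 1) \<le> 2"
    using norm_triangle_ineq4[of "z ^ N" 1] assms by (simp add: norm_power)
  then show ?thesis
    using assms by (simp add: geometric_sum norm_divide divide_right_mono)
qed

text \<open>
  Averaging over the powers of some \<open>s\<close> with \<open>\<theta> j s \<noteq> 1\<close> makes the coefficient of
  \<open>\<theta> j\<close> arbitrarily small and preserves the lower bound \<open>\<eta>\<close>.
\<close>

lemma (in group) nontrivial_combination_not_positive:
  assumes "finite I"
    and "\<And>i. i \<in> I \<Longrightarrow> \<theta> i \<in> hom G circle_group"
    and "\<And>i. i \<in> I \<Longrightarrow> \<exists>a\<in>carrier G. \<theta> i a \<noteq> 1"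
    and "\<And>a. a \<in> carrier G \<Longrightarrow> \<eta> \<le> Re (\<Sum>i\<in>I. c i * \<theta> i a)"
  shows "\<eta> \<le> 0"
  using assms
proof (induction I arbitrary: c \<eta>)
  case empty
  then show ?case
    using one_closed by fastforce
next
  case (insert j I)
  obtain s where s: "s \<in> carrier G" "\<theta> j s \<noteq> 1"
    using insert.prems(2) by blast
  \<comment> \<open>\<open>B\<close> bounds the \<open>j\<close>-term of a sum over the translates
    by \<open>s [^] k\<close>, \<open>k < N\<close>, for all \<open>N\<close> at once.\<close>
  define B where "B = norm (c j) * (2 / norm (\<theta> j s - 1))"
  have \<theta>1: "norm (\<theta> i a) = 1" if "i \<in> insert j I" "a \<in> carrier G" for i a
    using insert.prems(1)[OF that(1)] that(2) by (simp add: hom_circle_group_iff)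
  have \<theta>m: "\<theta> i (a \<otimes> b) = \<theta> i a * \<theta> i b"
    if "i \<in> insert j I" "a \<in> carrier G" "b \<in> carrier G" for i a b
    using insert.prems(1)[OF that(1)] that(2,3) by (simp add: hom_circle_group_iff)
  have \<theta>p: "\<theta> i (s [^] k) = \<theta> i s ^ k" if "i \<in> insert j I" for i and k :: nat
  proof (induction k)
    case 0
    then show ?case
      using \<theta>m[OF that, of \<one> \<one>] \<theta>1[OF that, of \<one>] by auto
  next
    case (Suc k)
    then show ?case
      using \<theta>m[OF that, of "s [^] k" s] s(1) by (simp add: mult.commute)
  qed
  \<comment> \<open>The induction hypothesis is applied to the sum of \<open>N\<close> translates
    without its \<open>j\<close>-term: the lower bound \<open>N * \<eta>\<close> loses at most
    \<open>B\<close>. As \<open>N\<close> is arbitrary, \<eta> cannot be positive.\<close>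
  have "real N * \<eta> - B \<le> 0" for N :: nat
  proof (rule insert.IH)
    fix a assume a: "a \<in> carrier G"
    let ?S = "\<lambda>i. \<Sum>k<N. \<theta> i s ^ k"
    have shift: "(\<Sum>k<N. c i * \<theta> i (a \<otimes> s [^] k)) = c i * ?S i * \<theta> i a"
      if "i \<in> insert j I" for i
      using \<theta>m[OF that a] \<theta>p[OF that] s(1)
      by (simp add: sum_distrib_left sum_distrib_right mult_ac)
    have "real N * \<eta> = (\<Sum>k<N. \<eta>)"
      by simp
    also have "\<dots> \<le> (\<Sum>k<N. Re (\<Sum>i\<in>insert j I. c i * \<theta> i (a \<otimes> s [^] k)))"
      using a s(1) by (intro sum_mono insert.prems(3)) auto
    also have "\<dots> = Re (\<Sum>i\<in>insert j I. \<Sum>k<N. c i * \<theta> i (a \<otimes> s [^] k))"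
      by (subst sum.swap) (simp only: Re_sum)
    also have "\<dots> = Re (\<Sum>i\<in>insert j I. c i * ?S i * \<theta> i a)"
      by (simp only: shift cong: sum.cong)
    also have "\<dots> = Re (c j * ?S j * \<theta> j a) + Re (\<Sum>i\<in>I. c i * ?S i * \<theta> i a)"
      using insert.hyps by simp
    also have "Re (c j * ?S j * \<theta> j a) \<le> norm (c j * ?S j * \<theta> j a)"
      by (rule complex_Re_le_cmod)
    also have "\<dots> = norm (c j) * norm (?S j)"
      using \<theta>1[of j a] a by (simp add: norm_mult)
    also have "\<dots> \<le> B"
      unfolding B_def using s(2) \<theta>1[of j s] s(1)
      by (intro mult_left_mono norm_sum_powers_le) auto
    finally show "real N * \<eta> - B \<le> Re (\<Sum>i\<in>I. c i * ?S i * \<theta> i a)"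
      by simp
  qed (use insert.prems in auto)
  then have *: "real N * \<eta> \<le> B" for N :: nat
    by simp
  show "\<eta> \<le> 0"
  proof (rule ccontr)
    assume "\<not> \<eta> \<le> 0"
    then obtain N :: nat where "B < real N * \<eta>"
      using reals_Archimedean3[of \<eta>] by auto
    with *[of N] show False
      by simp
  qed
qed

text \<open>Values are rounded to a finite \<open>d / 2\<close>-net of the circle. Only finitely
  many codes arise on the finite set \<open>C\<close>, and functions with equal codes differ there
  by less than \<open>d\<close>. One representative per code keeps the net inside
  \<open>A\<close>.\<close>

lemma finite_net_of_unimodular_functions:
  fixes A :: "('a \<Rightarrow> complex) set"
  assumes C: "finite C" and A: "\<forall>\<phi>\<in>A. \<forall>x\<in>C. norm (\<phi> x) = 1" and d: "0 < d"
  shows "\<exists>B. finite B \<and> B \<subseteq> A \<and> (\<forall>\<phi>\<in>A. \<exists>\<psi>\<in>B. \<forall>x\<in>C. dist (\<phi> x) (\<psi> x) < d)"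
proof -
  have "compact (sphere (0::complex) 1)"
    by simp
  then obtain S where S: "finite S" "sphere (0::complex) 1 \<subseteq> (\<Union>s\<in>S. ball s (d / 2))"
    using d unfolding compact_eq_totally_bounded by (meson half_gt_zero)
  define near where "near z = (SOME s. s \<in> S \<and> dist s z < d / 2)" for z :: complex
  have near: "near z \<in> S" "dist (near z) z < d / 2" if "norm z = 1" for z
  proof -
    have "\<exists>s. s \<in> S \<and> dist s z < d / 2"
      using S(2) that by (auto simp: subset_iff)
    from someI_ex[OF this] show "near z \<in> S" "dist (near z) z < d / 2"
      by (simp_all add: near_def)
  qed
  define code where "code \<phi> = (\<lambda>x\<in>C. near (\<phi> x))" for \<phi> :: "'a \<Rightarrow> complex"
  have "code ` A \<subseteq> (\<Pi>\<^sub>E x\<in>C. S)"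
    using A near by (auto simp: code_def)
  then have "finite (code ` A)"
    by (rule finite_subset) (simp add: finite_PiE C S)
  then have "\<exists>B\<subseteq>A. finite B \<and> code ` A = code ` B"
    by (rule finite_subset_image) simp
  then obtain B where B: "finite B" "B \<subseteq> A" "code ` A = code ` B"
    by blast
  show ?thesis
  proof (intro exI conjI ballI, rule B(1), rule B(2))
    fix \<phi> assume \<phi>: "\<phi> \<in> A"
    then obtain \<psi> where \<psi>: "\<psi> \<in> B" "code \<phi> = code \<psi>"
      using B(3) by blast
    have "dist (\<phi> x) (\<psi> x) < d" if x: "x \<in> C" for x
    proof -
      have "near (\<phi> x) = near (\<psi> x)"
        using fun_cong[OF \<psi>(2), of x] x by (simp add: code_def)
      moreover have "norm (\<phi> x) = 1" "norm (\<psi> x) = 1"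
        using A x \<phi> \<psi>(1) B(2) by auto
      ultimately show ?thesis
        using near(2)[of "\<phi> x"] near(2)[of "\<psi> x"] dist_triangle_half_r by metis
    qed
    with \<psi> show "\<exists>\<psi>\<in>B. \<forall>x\<in>C. dist (\<phi> x) (\<psi> x) < d"
      by blast
  qed
qed

text \<open>Expresses a factor of the kernel by the distance from 1: it falls off quadratically,
  which gives the upper bound away from 1 and the lower bound near 1.\<close>

lemma half_one_plus_Re:
  fixes z :: complex
  assumes "norm z = 1"
  shows "(1 + Re z) / 2 = 1 - (dist z 1)\<^sup>2 / 4"
proof -
  have "(Re z)\<^sup>2 + (Im z)\<^sup>2 = 1"
    using assms by (simp flip: cmod_power2)
  then have "(dist z 1)\<^sup>2 = 2 - 2 * Re z"
    unfolding dist_norm cmod_power2 by (simp add: power2_eq_square algebra_simps)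
  then show ?thesis
    by (simp add: field_simps)
qed

section \<open>Trigonometric polynomials and finitely determined homomorphisms on the dual\<close>

context topological_ab_group
begin

definition trigonometric_polynomial :: "(('a \<Rightarrow> complex) \<Rightarrow> complex) \<Rightarrow> bool" where
  "trigonometric_polynomial f \<longleftrightarrow>
     (\<exists>F c. finite F \<and> F \<subseteq> carrier G \<and> (\<forall>\<phi>\<in>characters G T. f \<phi> = (\<Sum>x\<in>F. c x * \<phi> x)))"

text \<open>Group elements may repeat among the \<open>x i\<close>; equal ones are collected.
  Products and sums can then be presented without tracking coincidences.\<close>

lemma trigonometric_polynomialI:
  assumes "finite I" "\<And>i. i \<in> I \<Longrightarrow> x i \<in> carrier G"
    and "\<And>\<phi>. \<phi> \<in> characters G T \<Longrightarrow> f \<phi> = (\<Sum>i\<in>I. c i * \<phi> (x i))"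
  shows "trigonometric_polynomial f"
  unfolding trigonometric_polynomial_def
proof (intro exI conjI ballI)
  show "finite (x ` I)" "x ` I \<subseteq> carrier G"
    using assms by auto
  fix \<phi> assume "\<phi> \<in> characters G T"
  then have "f \<phi> = (\<Sum>i\<in>I. c i * \<phi> (x i))"
    by (rule assms(3))
  also have "\<dots> = (\<Sum>y\<in>x ` I. \<Sum>i\<in>{i \<in> I. x i = y}. c i * \<phi> (x i))"
    using assms(1) by (rule sum.image_gen)
  also have "\<dots> = (\<Sum>y\<in>x ` I. (\<Sum>i\<in>{i \<in> I. x i = y}. c i) * \<phi> y)"
    by (simp add: sum_distrib_right)
  finally show "f \<phi> = (\<Sum>y\<in>x ` I. (\<Sum>i\<in>{i \<in> I. x i = y}. c i) * \<phi> y)" .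
qed

lemma trigonometric_polynomial_mult:
  assumes "trigonometric_polynomial f" "trigonometric_polynomial g"
  shows "trigonometric_polynomial (\<lambda>\<phi>. f \<phi> * g \<phi>)"
proof -
  obtain F c where F: "finite F" "F \<subseteq> carrier G"
    "\<And>\<phi>. \<phi> \<in> characters G T \<Longrightarrow> f \<phi> = (\<Sum>x\<in>F. c x * \<phi> x)"
    using assms(1) unfolding trigonometric_polynomial_def by blast
  obtain E d where E: "finite E" "E \<subseteq> carrier G"
    "\<And>\<phi>. \<phi> \<in> characters G T \<Longrightarrow> g \<phi> = (\<Sum>x\<in>E. d x * \<phi> x)"
    using assms(2) unfolding trigonometric_polynomial_def by blast
  show ?thesis
  proof (rule trigonometric_polynomialI)
    show "finite (F \<times> E)"
      using F E by simp
    show "fst p \<otimes> snd p \<in> carrier G" if "p \<in> F \<times> E" for p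
      using F(2) E(2) that by (auto simp: subset_iff)
    fix \<phi> assume \<phi>: "\<phi> \<in> characters G T"
    have "f \<phi> * g \<phi> = (\<Sum>p\<in>F \<times> E. (c (fst p) * \<phi> (fst p)) * (d (snd p) * \<phi> (snd p)))"
      using F(3)[OF \<phi>] E(3)[OF \<phi>] by (simp add: sum_product sum.cartesian_product case_prod_unfold)
    also have "\<dots> = (\<Sum>p\<in>F \<times> E. c (fst p) * d (snd p) * \<phi> (fst p \<otimes> snd p))"
    proof (rule sum.cong[OF refl])
      fix p assume "p \<in> F \<times> E"
      then have "fst p \<in> carrier G" "snd p \<in> carrier G"
        using F(2) E(2) by (auto simp: subset_iff)
      then show "(c (fst p) * \<phi> (fst p)) * (d (snd p) * \<phi> (snd p)) =
          c (fst p) * d (snd p) * \<phi> (fst p \<otimes> snd p)"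
        using characterD(2)[OF \<phi>] by simp
    qed
    finally show "f \<phi> * g \<phi> = (\<Sum>p\<in>F \<times> E. c (fst p) * d (snd p) * \<phi> (fst p \<otimes> snd p))" .
  qed
qed

lemma trigonometric_polynomial_one: "trigonometric_polynomial (\<lambda>\<phi>. 1)"
  by (rule trigonometric_polynomialI[of "{()}" "\<lambda>_. \<one>" _ "\<lambda>_. 1"]) (auto simp: character_one)

lemma trigonometric_polynomial_prod:
  assumes "\<And>x. x \<in> C \<Longrightarrow> trigonometric_polynomial (f x)"
  shows "trigonometric_polynomial (\<lambda>\<phi>. \<Prod>x\<in>C. f x \<phi>)"
  using assms
  by (induction C rule: infinite_finite_induct)
    (auto simp: trigonometric_polynomial_one trigonometric_polynomial_mult)

lemma trigonometric_polynomial_cong: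
  assumes "trigonometric_polynomial f" "\<And>\<phi>. \<phi> \<in> characters G T \<Longrightarrow> f \<phi> = g \<phi>"
  shows "trigonometric_polynomial g"
  using assms unfolding trigonometric_polynomial_def by (metis)

lemma trigonometric_polynomial_half_one_plus:
  assumes x: "x \<in> carrier G"
  shows "trigonometric_polynomial (\<lambda>\<phi>. of_real ((1 + Re (\<phi> x)) / 2))"
proof -
  \<comment> \<open>The index type \<open>bool\<close> has one index for each of the two terms; the
    constant term is the value at the identity.\<close>
  have *: "trigonometric_polynomial (\<lambda>\<phi>. (1 + \<phi> y) / 2)" if "y \<in> carrier G" for y
    by (rule trigonometric_polynomialI[of UNIV "\<lambda>b. if b then y else \<one>" _ "\<lambda>_. 1 / 2"])
      (use that in \<open>auto simp: UNIV_bool character_one add_divide_distrib\<close>)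
  show ?thesis
  proof (rule trigonometric_polynomial_cong)
    \<comment> \<open>\<open>\<phi> (inv x)\<close> is the conjugate of \<open>\<phi> x\<close>, so
      this product is \<open>|(1 + \<phi> x) / 2|^2\<close>, which on the circle equals the desired
      factor.\<close>
    show "trigonometric_polynomial (\<lambda>\<phi>. (1 + \<phi> x) / 2 * ((1 + \<phi> (inv x)) / 2))"
      using x by (intro trigonometric_polynomial_mult *) auto
    fix \<phi> assume \<phi>: "\<phi> \<in> characters G T"
    have "cnj (\<phi> x) * \<phi> x = 1"
      using characterD(1)[OF \<phi> x] by (rule cnj_mult_self_eq_1)
    then have "(1 + \<phi> x) * (1 + \<phi> (inv x)) = 2 + (\<phi> x + cnj (\<phi> x))"
      using character_inv[OF \<phi> x] by (simp add: algebra_simps)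
    also have "\<dots> = 2 * of_real (1 + Re (\<phi> x))"
      by (simp add: complex_add_cnj)
    finally show "(1 + \<phi> x) / 2 * ((1 + \<phi> (inv x)) / 2) = of_real ((1 + Re (\<phi> x)) / 2)"
      by simp
  qed
qed

text \<open>
  Comfort and Ross: the idea is to convolve \<open>\<xi>\<close> with the kernel
  \<open>K \<phi> = (\<Prod>x\<in>C. (1 + Re (\<phi> x)) / 2) ^ n\<close>, which concentrates near the trivial character as
  \<open>n\<close> grows. Summing over a finite net \<open>B\<close> replaces the integral over the dual group.
\<close>

lemma finitely_determined_hom_is_evaluation:
  assumes \<xi>: "\<xi> \<in> hom (dual_group G T) circle_group"
    and C: "finite C" "C \<subseteq> carrier G" and e: "0 < e"
    and small: "\<And>\<phi>. \<phi> \<in> characters G T \<Longrightarrow> \<forall>x\<in>C. dist (\<phi> x) 1 < e \<Longrightarrow> dist (\<xi> \<phi>) 1 < 1"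
  obtains x where "x \<in> carrier G" "\<And>\<phi>. \<phi> \<in> characters G T \<Longrightarrow> \<xi> \<phi> = \<phi> x"
proof -
  interpret D: comm_group "dual_group G T"
    by (rule comm_group_dual)
  let ?X = "characters G T"
  have \<xi>1: "norm (\<xi> \<phi>) = 1" if "\<phi> \<in> ?X" for \<phi>
    using \<xi> that by (simp add: hom_circle_group_iff)
  have \<xi>m: "\<xi> (\<phi> \<otimes>\<^bsub>dual_group G T\<^esub> \<psi>) = \<xi> \<phi> * \<xi> \<psi>" if "\<phi> \<in> ?X" "\<psi> \<in> ?X" for \<phi> \<psi>
    using \<xi> that by (simp add: hom_circle_group_iff)
  define m where "m = card C"
  \<comment> \<open>The kernel \<open>P\<close> will be at most \<open>q\<close> if some value on
    \<open>C\<close> has distance at least \<open>e'\<close> from 1, and at least \<open>p\<close>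
    if all are within \<open>d\<close>. The divisor \<open>m + 1\<close> in \<open>d\<close> gives
    \<open>m d^2 < e'^2\<close>, hence \<open>q < p\<close>; the cap \<open>e' \<le> 1\<close> keeps
    \<open>q\<close> positive.\<close>
  define e' where "e' = min e 1"
  define d where "d = e' / (real m + 1)"
  define q where "q = 1 - e'\<^sup>2 / 4"
  define p where "p = 1 - real m * (d\<^sup>2 / 4)"
  have e': "0 < e'" "e' \<le> 1" "e' \<le> e"
    using e by (auto simp: e'_def)
  have d: "0 < d" "d \<le> e'"
    using e' by (auto simp: d_def field_simps)
  have "real m * d\<^sup>2 < e'\<^sup>2"
  proof -
    have "real m * e'\<^sup>2 < (real m + 1)\<^sup>2 * e'\<^sup>2"
      using e' by (intro mult_strict_right_mono) (auto simp: power2_eq_square algebra_simps add_pos_nonneg)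
    then show ?thesis
      by (simp add: d_def power_divide field_simps)
  qed
  moreover have "e'\<^sup>2 \<le> 1"
    using e' by (simp add: power_le_one)
  ultimately have pq: "0 < q" "q < p"
    by (auto simp: p_def q_def)
  define P where "P \<phi> = (\<Prod>x\<in>C. (1 + Re (\<phi> x)) / 2)" for \<phi> :: "'a \<Rightarrow> complex"
  have factor: "0 \<le> (1 + Re (\<phi> x)) / 2" "(1 + Re (\<phi> x)) / 2 \<le> 1"
    if "\<phi> \<in> ?X" "x \<in> C" for \<phi> x
    using abs_Re_le_cmod[of "\<phi> x"] characterD(1)[OF that(1), of x] that(2) C(2) by auto
  have P0: "0 \<le> P \<phi>" if "\<phi> \<in> ?X" for \<phi>
    unfolding P_def using factor[OF that] by (intro prod_nonneg) auto
  have P_far: "P \<phi> \<le> q" if \<phi>: "\<phi> \<in> ?X" and x: "x \<in> C" "e' \<le> dist (\<phi> x) 1" for \<phi> x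
  proof -
    have "P \<phi> = (1 + Re (\<phi> x)) / 2 * (\<Prod>x\<in>C - {x}. (1 + Re (\<phi> x)) / 2)"
      unfolding P_def using C(1) x(1) by (rule prod.remove)
    also have "\<dots> \<le> (1 + Re (\<phi> x)) / 2 * 1"
      using factor[OF \<phi>] x(1) by (intro mult_left_mono prod_le_1) auto
    also have "\<dots> = 1 - (dist (\<phi> x) 1)\<^sup>2 / 4"
      using half_one_plus_Re characterD(1)[OF \<phi>, of x] x(1) C(2) by auto
    also have "\<dots> \<le> q"
      unfolding q_def using e' x(2) by (simp add: power_mono)
    finally show ?thesis .
  qed
  have P_near: "p \<le> P \<phi>" if \<phi>: "\<phi> \<in> ?X" and near: "\<forall>x\<in>C. dist (\<phi> x) 1 < d" for \<phi>
  proof -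
    have "d\<^sup>2 \<le> 1"
      using d e' by (intro power_le_one) auto
    then have "p \<le> (1 - d\<^sup>2 / 4) ^ m"
      using Bernoulli_inequality[of "- (d\<^sup>2 / 4)" m] by (simp add: p_def)
    also have "\<dots> = (\<Prod>x\<in>C. 1 - d\<^sup>2 / 4)"
      by (simp add: m_def)
    also have "\<dots> \<le> (\<Prod>x\<in>C. (1 + Re (\<phi> x)) / 2)"
    proof (rule prod_mono)
      fix x assume x: "x \<in> C"
      have "(dist (\<phi> x) 1)\<^sup>2 \<le> d\<^sup>2"
        using near x by (intro power_mono) auto
      then show "0 \<le> 1 - d\<^sup>2 / 4 \<and> 1 - d\<^sup>2 / 4 \<le> (1 + Re (\<phi> x)) / 2"
        using half_one_plus_Re[of "\<phi> x"] characterD(1)[OF \<phi>, of x] x C(2) \<open>d\<^sup>2 \<le> 1\<close> by auto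
    qed
    finally show ?thesis
      by (simp add: P_def)
  qed
  have unimodular: "\<forall>\<phi>\<in>?X. \<forall>x\<in>C. norm (\<phi> x) = 1"
    using characterD(1) C(2) by blast
  obtain B where B: "finite B" "B \<subseteq> ?X"
    "\<forall>\<phi>\<in>?X. \<exists>\<psi>\<in>B. \<forall>x\<in>C. dist (\<phi> x) (\<psi> x) < d"
    using finite_net_of_unimodular_functions[OF C(1) unimodular d(1)] by (elim exE conjE)
  define b where "b = card B"
  \<comment> \<open>Since \<open>q < p\<close>, a high power lets one term of size
    \<open>p ^ n / 2\<close> outweigh \<open>b\<close> terms of size \<open>- q ^ n\<close>; the
    excess is \<eta>.\<close>
  obtain n where n: "(q / p) ^ n < 1 / (2 * real b + 1)"
    using real_arch_pow_inv[of "1 / (2 * real b + 1)" "q / p"] pq by auto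
  define \<eta> where "\<eta> = p ^ n / 2 - real b * q ^ n"
  have "(2 * real b + 1) * q ^ n < p ^ n"
  proof -
    have "0 < p ^ n"
      using pq by simp
    moreover have "q ^ n / p ^ n < 1 / (2 * real b + 1)"
      using n by (simp only: power_divide)
    ultimately have "q ^ n < p ^ n / (2 * real b + 1)"
      by (simp only: pos_divide_less_eq times_divide_eq_left mult_1_left)
    moreover have "0 < 2 * real b + 1"
      by (simp add: add_nonneg_pos)
    ultimately show ?thesis
      by (simp only: pos_less_divide_eq mult.commute)
  qed
  moreover have "0 < q ^ n"
    using pq by simp
  ultimately have \<eta>: "0 < \<eta>"
    by (simp add: \<eta>_def algebra_simps)
  have "trigonometric_polynomial (\<lambda>\<phi>. \<Prod>i<n. \<Prod>x\<in>C. of_real ((1 + Re (\<phi> x)) / 2))"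
    using C(2) by (intro trigonometric_polynomial_prod trigonometric_polynomial_half_one_plus) auto
  then have "trigonometric_polynomial (\<lambda>\<phi>. of_real (P \<phi> ^ n))"
    by (rule trigonometric_polynomial_cong) (simp add: P_def)
  then obtain F c where F: "finite F" "F \<subseteq> carrier G"
    and Fc: "\<And>\<phi>. \<phi> \<in> ?X \<Longrightarrow> of_real (P \<phi> ^ n) = (\<Sum>x\<in>F. c x * \<phi> x)"
    unfolding trigonometric_polynomial_def by blast
  \<comment> \<open>If \<xi> times the evaluation at some \<open>x\<close> in \<open>F\<close> is
    trivial, then \<xi> is the evaluation at \<open>inv x\<close>. Otherwise the expansion of the
    kernel yields a combination of nontrivial homomorphisms with real part at least \<eta>, which is
    impossible for positive \<eta>.\<close>
  define \<theta> where "\<theta> x \<phi> = \<xi> \<phi> * \<phi> x" for x :: 'a and \<phi> :: "'a \<Rightarrow> complex"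
  have \<theta>m: "\<theta> x (\<phi> \<otimes>\<^bsub>dual_group G T\<^esub> \<psi>) = \<theta> x \<phi> * \<theta> x \<psi>"
    if "x \<in> F" "\<phi> \<in> ?X" "\<psi> \<in> ?X" for x \<phi> \<psi>
    using \<xi>m[OF that(2,3)] that F(2) by (auto simp: \<theta>_def)
  have \<theta>_hom: "\<theta> x \<in> hom (dual_group G T) circle_group" if "x \<in> F" for x
    unfolding hom_circle_group_iff using \<theta>m[OF that] \<xi>1 characterD(1) that F(2)
    by (auto simp: \<theta>_def norm_mult simp del: dual_group_simps(2))
  \<comment> \<open>Either all values on \<open>C\<close> are close to 1 and \<open>small\<close>
    puts \<open>\<xi> \<phi>\<close> in the right half-plane, or the kernel itself is at most
    \<open>q ^ n\<close>.\<close>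
  have lower: "- (q ^ n) \<le> Re (\<xi> \<phi> * of_real (P \<phi> ^ n))" if \<phi>: "\<phi> \<in> ?X" for \<phi>
  proof (cases "\<forall>x\<in>C. dist (\<phi> x) 1 < e'")
    case True
    then have "dist (\<xi> \<phi>) 1 < 1"
      using small[OF \<phi>] e' by force
    then have "0 \<le> Re (\<xi> \<phi>)"
      using abs_Re_le_cmod[of "\<xi> \<phi> - 1"] by (simp add: dist_norm)
    then have "0 \<le> Re (\<xi> \<phi>) * P \<phi> ^ n"
      using P0[OF \<phi>] by simp
    moreover have "- (q ^ n) \<le> 0"
      using pq by simp
    ultimately show ?thesis
      by (simp del: neg_le_0_iff_le)
  next
    case False
    then have "P \<phi> ^ n \<le> q ^ n"
      using P_far[OF \<phi>] P0[OF \<phi>] by (intro power_mono) (auto simp: not_less)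
    moreover have "- norm (\<xi> \<phi> * of_real (P \<phi> ^ n)) \<le> Re (\<xi> \<phi> * of_real (P \<phi> ^ n))"
      using abs_Re_le_cmod[of "\<xi> \<phi> * of_real (P \<phi> ^ n)"] by linarith
    moreover have "norm (\<xi> \<phi> * of_real (P \<phi> ^ n)) = P \<phi> ^ n"
      using \<xi>1[OF \<phi>] P0[OF \<phi>] by (simp add: norm_mult norm_power)
    ultimately show ?thesis
      by linarith
  qed
  have near: "p ^ n / 2 \<le> Re (\<xi> \<phi> * of_real (P \<phi> ^ n))"
    if \<phi>: "\<phi> \<in> ?X" and nr: "\<forall>x\<in>C. dist (\<phi> x) 1 < d" for \<phi>
  proof -
    have "dist (\<xi> \<phi>) 1 < 1"
      using small[OF \<phi>] nr d e' by force
    then have "(norm (\<xi> \<phi> - 1))\<^sup>2 \<le> 1"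
      by (simp add: dist_norm power_le_one)
    then have "1 / 2 \<le> Re (\<xi> \<phi>)"
      using half_one_plus_Re[OF \<xi>1[OF \<phi>]] by (simp add: dist_norm)
    moreover have "p ^ n \<le> P \<phi> ^ n"
      using P_near[OF \<phi> nr] pq by (intro power_mono) auto
    moreover have "0 \<le> p ^ n"
      using pq by simp
    ultimately have "1 / 2 * p ^ n \<le> Re (\<xi> \<phi>) * P \<phi> ^ n"
      by (intro mult_mono) auto
    then show ?thesis
      by simp
  qed
  have "\<exists>x\<in>F. \<forall>\<phi>\<in>?X. \<theta> x \<phi> = 1"
  proof (rule ccontr)
    assume no: "\<not> (\<exists>x\<in>F. \<forall>\<phi>\<in>?X. \<theta> x \<phi> = 1)"
    have "\<eta> \<le> 0"
    proof (rule D.nontrivial_combination_not_positive[OF F(1) \<theta>_hom])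
      show "\<exists>\<phi>\<in>carrier (dual_group G T). \<theta> x \<phi> \<noteq> 1" if "x \<in> F" for x
        using no that by auto
      fix \<phi> assume "\<phi> \<in> carrier (dual_group G T)"
      then have \<phi>: "\<phi> \<in> ?X"
        by simp
      \<comment> \<open>The kernel is translated by each \<psi> of the net. For one of them
        \<open>\<gamma> \<psi>\<close> is within \<open>d\<close> of the trivial character on
        \<open>C\<close>, so \<open>near\<close> applies; \<open>lower\<close> controls the
        others.\<close>
      define \<gamma> where "\<gamma> \<psi> = \<phi> \<otimes>\<^bsub>dual_group G T\<^esub> inv\<^bsub>dual_group G T\<^esub> \<psi>" for \<psi>
      have inv\<psi>: "inv\<^bsub>dual_group G T\<^esub> \<psi> \<in> ?X" if "\<psi> \<in> ?X" for \<psi>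
        using D.inv_closed[of \<psi>] that by simp
      have \<gamma>X: "\<gamma> \<psi> \<in> ?X" if "\<psi> \<in> ?X" for \<psi>
        using D.m_closed[OF _ D.inv_closed, of \<phi> \<psi>] that \<phi> by (simp add: \<gamma>_def)
      have \<gamma>_near: "dist (\<gamma> \<psi> x) 1 = dist (\<phi> x) (\<psi> x)" if "\<psi> \<in> ?X" "x \<in> carrier G" for \<psi> x
      proof -
        have "\<gamma> \<psi> x - 1 = (\<phi> x - \<psi> x) * cnj (\<psi> x)"
          using that cnj_mult_self_eq_1[OF characterD(1)[OF that]]
          by (simp add: \<gamma>_def dual_inv algebra_simps)
        then show ?thesis
          using characterD(1)[OF that] by (simp add: dist_norm norm_mult)
      qed
      obtain \<psi> where \<psi>: "\<psi> \<in> B" "\<forall>x\<in>C. dist (\<phi> x) (\<psi> x) < d"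
        using bspec[OF B(3) \<phi>] by blast
      have \<psi>X: "\<psi> \<in> ?X"
        using \<psi> B by blast
      let ?r = "\<lambda>\<psi>. Re (\<xi> (\<gamma> \<psi>) * of_real (P (\<gamma> \<psi>) ^ n))"
      have "\<forall>x\<in>C. dist (\<gamma> \<psi> x) 1 < d"
        using \<psi>(2) \<gamma>_near[OF \<psi>X] C(2) by auto
      \<comment> \<open>Adding \<open>q ^ n\<close> makes every summand nonnegative, so the one good
        summand is at most the sum.\<close>
      then have "p ^ n / 2 + q ^ n \<le> ?r \<psi> + q ^ n"
        using near[OF \<gamma>X[OF \<psi>X]] by simp
      also have "\<dots> \<le> (\<Sum>\<psi>\<in>B. ?r \<psi> + q ^ n)"
      proof (rule member_le_sum[OF \<psi>(1) _ B(1)])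
        fix \<zeta> assume "\<zeta> \<in> B - {\<psi>}"
        then show "0 \<le> ?r \<zeta> + q ^ n"
          using lower[OF \<gamma>X[of \<zeta>]] B(2) by auto
      qed
      also have "\<dots> = (\<Sum>\<psi>\<in>B. ?r \<psi>) + real b * q ^ n"
        by (simp add: sum.distrib b_def)
      finally have "\<eta> \<le> (\<Sum>\<psi>\<in>B. ?r \<psi>)"
        using \<open>0 < q ^ n\<close> unfolding \<eta>_def by linarith
      also have "\<dots> = Re (\<Sum>\<psi>\<in>B. \<xi> (\<gamma> \<psi>) * (\<Sum>x\<in>F. c x * \<gamma> \<psi> x))"
        unfolding Re_sum
      proof (rule sum.cong[OF refl])
        fix \<psi> assume "\<psi> \<in> B"
        then have "\<gamma> \<psi> \<in> ?X"
          using B(2) \<gamma>X by blast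
        then show "?r \<psi> = Re (\<xi> (\<gamma> \<psi>) * (\<Sum>x\<in>F. c x * \<gamma> \<psi> x))"
          by (simp only: Fc)
      qed
      also have "(\<Sum>\<psi>\<in>B. \<xi> (\<gamma> \<psi>) * (\<Sum>x\<in>F. c x * \<gamma> \<psi> x)) = (\<Sum>\<psi>\<in>B. \<Sum>x\<in>F. c x * \<theta> x (\<gamma> \<psi>))"
        by (simp add: \<theta>_def sum_distrib_left mult_ac)
      also have "\<dots> = (\<Sum>x\<in>F. \<Sum>\<psi>\<in>B. c x * \<theta> x (\<gamma> \<psi>))"
        by (rule sum.swap)
      \<comment> \<open>Multiplicativity of \<open>\<theta> x\<close> separates \<psi> from \<phi>:
        summing over the net only changes coefficients.\<close>
      also have "\<dots> = (\<Sum>x\<in>F. (\<Sum>\<psi>\<in>B. c x * \<theta> x (inv\<^bsub>dual_group G T\<^esub> \<psi>)) * \<theta> x \<phi>)"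
      proof (rule sum.cong[OF refl])
        fix x assume x: "x \<in> F"
        have "\<theta> x (\<gamma> \<psi>) = \<theta> x (inv\<^bsub>dual_group G T\<^esub> \<psi>) * \<theta> x \<phi>" if "\<psi> \<in> B" for \<psi>
          unfolding \<gamma>_def using \<theta>m[OF x \<phi> inv\<psi>] that B(2) by (auto simp: mult.commute)
        then show "(\<Sum>\<psi>\<in>B. c x * \<theta> x (\<gamma> \<psi>)) =
            (\<Sum>\<psi>\<in>B. c x * \<theta> x (inv\<^bsub>dual_group G T\<^esub> \<psi>)) * \<theta> x \<phi>"
          unfolding sum_distrib_right by (intro sum.cong) (simp_all add: mult_ac)
      qed
      finally show "\<eta> \<le> Re (\<Sum>x\<in>F. (\<Sum>\<psi>\<in>B. c x * \<theta> x (inv\<^bsub>dual_group G T\<^esub> \<psi>)) * \<theta> x \<phi>)" .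
    qed
    with \<eta> show False
      by simp
  qed
  then obtain x where x: "x \<in> F" "\<And>\<phi>. \<phi> \<in> ?X \<Longrightarrow> \<xi> \<phi> * \<phi> x = 1"
    unfolding \<theta>_def by blast
  have xG: "x \<in> carrier G"
    using x F by blast
  have "\<xi> \<phi> = \<phi> (inv x)" if \<phi>: "\<phi> \<in> ?X" for \<phi>
  proof -
    have "\<xi> \<phi> * \<phi> x = cnj (\<phi> x) * \<phi> x"
      using x(2)[OF \<phi>] cnj_mult_self_eq_1[OF characterD(1)[OF \<phi> xG]] by simp
    moreover have "\<phi> x \<noteq> 0"
      using characterD(1)[OF \<phi> xG] by auto
    ultimately show ?thesis
      by (simp add: character_inv[OF \<phi> xG])
  qed
  then show thesis
    using xG by (intro that[of "inv x"]) auto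
qed

end

section \<open>Reflexivity of P-groups\<close>

text \<open>Points are closed, so some open subgroup misses the quotient of two distinct points, and
  a character annihilating it separates them.\<close>

lemma (in P_ab_group) inj_on_evaluation: "inj_on (evaluation G T) (carrier G)"
proof (rule inj_onI, rule ccontr)
  fix x y assume xy: "x \<in> carrier G" "y \<in> carrier G"
    and eq: "evaluation G T x = evaluation G T y" and "x \<noteq> y"
  let ?z = "x \<otimes> inv y"
  have z: "?z \<in> carrier G" "?z \<noteq> \<one>"
  proof -
    show "?z \<in> carrier G"
      using xy by simp
    show "?z \<noteq> \<one>"
      using xy \<open>x \<noteq> y\<close> inv_equality[of x "inv y"] by auto
  qed
  have "openin T (topspace T - {?z})"
    using Hausdorff z closedin_Hausdorff_sing_eq topspace_eq by fastforce
  moreover have "\<one> \<in> topspace T - {?z}"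
    using z by (simp add: topspace_eq)
  ultimately obtain N where N: "subgroup N G" "openin T N" "N \<subseteq> topspace T - {?z}"
    by (rule open_subgroup_nhd)
  then have "?z \<notin> N"
    by blast
  then obtain \<phi> where \<phi>: "\<phi> \<in> annihilator G T N" "1 \<le> dist (\<phi> ?z) 1"
    by (rule annihilator_separates[OF N(1,2) z(1)])
  then have char: "\<phi> \<in> characters G T"
    by (simp add: annihilator_def)
  have "\<phi> x = \<phi> y"
    using fun_cong[OF eq, of \<phi>] char by (simp add: evaluation_def)
  then have "\<phi> ?z = \<phi> y * \<phi> (inv y)"
    using characterD(2)[OF char, of x "inv y"] xy by simp
  also have "\<dots> = \<phi> (y \<otimes> inv y)"
    using characterD(2)[OF char, of y "inv y"] xy by (simp only: inv_closed)
  also have "\<dots> = 1"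
    using xy character_one[OF char] by simp
  finally have "\<phi> ?z = 1" .
  with \<phi>(2) show False
    by simp
qed

text \<open>Continuity of \<xi> at the trivial character provides a compact, hence finite, set
  \<open>C\<close> and a radius \<open>e\<close> as required by
  \<open>finitely_determined_hom_is_evaluation\<close>.\<close>

lemma (in P_ab_group) evaluation_surj:
  assumes \<xi>: "\<xi> \<in> characters (dual_group G T) (dual_topology G T)"
  shows "\<xi> \<in> evaluation G T ` carrier G"
proof -
  have hom: "\<xi> \<in> hom (dual_group G T) circle_group" and ext: "\<xi> \<in> extensional (characters G T)"
    and cont: "continuous_map (dual_topology G T) euclidean \<xi>"
    using \<xi> by (auto simp: mem_characters_iff)
  let ?U = "{\<phi> \<in> topspace (dual_topology G T). \<xi> \<phi> \<in> ball 1 1}"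
  let ?e = "\<lambda>x\<in>carrier G. 1 :: complex"
  have "openin (dual_topology G T) ?U"
    using cont by (rule openin_continuous_map_preimage) simp
  moreover have "?e \<in> ?U"
  proof -
    have "norm (\<xi> ?e) = 1" "\<xi> (?e \<otimes>\<^bsub>dual_group G T\<^esub> ?e) = \<xi> ?e * \<xi> ?e"
      using hom trivial_character unfolding hom_circle_group_iff dual_group_simps(1) by blast+
    moreover have "?e \<otimes>\<^bsub>dual_group G T\<^esub> ?e = ?e"
      unfolding dual_group_simps by (rule restrict_ext) simp
    ultimately have "\<xi> ?e = \<xi> ?e * \<xi> ?e" "\<xi> ?e \<noteq> 0"
      by (auto simp only: norm_zero zero_neq_one)
    then have "\<xi> ?e \<in> ball 1 1"
      by auto
    then show ?thesis
      using trivial_character unfolding topspace_dual_topology by blast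
  qed
  ultimately obtain C e where C: "compactin T C" "0 < e"
    and sub: "{\<psi> \<in> characters G T. \<forall>x\<in>C. dist (\<psi> x) (?e x) < e} \<subseteq> ?U"
    unfolding openin_dual_topology by meson
  have CG: "C \<subseteq> carrier G"
    using compactin_subset_topspace[OF C(1)] topspace_eq by simp
  have "dist (\<xi> \<phi>) 1 < 1" if \<phi>: "\<phi> \<in> characters G T" "\<forall>x\<in>C. dist (\<phi> x) 1 < e" for \<phi>
  proof -
    have "\<forall>x\<in>C. dist (\<phi> x) (?e x) < e"
      using \<phi>(2) CG by auto
    then have "\<phi> \<in> ?U"
      using \<phi>(1) sub by blast
    then show ?thesis
      by (simp add: dist_commute)
  qed
  then obtain x where x: "x \<in> carrier G" "\<And>\<phi>. \<phi> \<in> characters G T \<Longrightarrow> \<xi> \<phi> = \<phi> x"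
    by (rule finitely_determined_hom_is_evaluation[OF hom compactin_finite[OF C(1)] CG C(2)]) blast+
  have "\<xi> = evaluation G T x"
    using x(2) ext by (intro extensionalityI[of _ "characters G T"]) (auto simp: evaluation_def)
  with x(1) show ?thesis
    by blast
qed

lemma (in P_ab_group) evaluation_image:
  "evaluation G T ` carrier G = characters (dual_group G T) (dual_topology G T)"
  using evaluation_surj evaluation_mem_characters by blast

text \<open>Take an open subgroup \<open>N\<close> with \<open>x N\<close> inside \<open>U\<close>.
  A character of the dual within 1 of \<alpha> on the compact annihilator of \<open>N\<close> is the
  evaluation at some \<open>y\<close>, and \<open>y\<close> lies in \<open>x N\<close>: otherwise an
  annihilating character would move \<open>inv x \<otimes> y\<close> to distance at least 1 from
  1.\<close>

lemma (in P_ab_group) openin_evaluation_image: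
  assumes U: "openin T U"
  shows "openin (bidual_topology G T) (evaluation G T ` U)"
  unfolding openin_dual_topology
proof (intro conjI ballI)
  have UG: "U \<subseteq> carrier G"
    using U openin_carrier by blast
  then show "evaluation G T ` U \<subseteq> characters (dual_group G T) (dual_topology G T)"
    using evaluation_mem_characters by blast
  fix \<alpha> assume "\<alpha> \<in> evaluation G T ` U"
  then obtain x where x: "x \<in> U" "\<alpha> = evaluation G T x"
    by blast
  have xG: "x \<in> carrier G"
    using x UG by blast
  have "openin T {y \<in> carrier G. x \<otimes> y \<in> U}" "\<one> \<in> {y \<in> carrier G. x \<otimes> y \<in> U}"
    using openin_translation[OF xG U] x xG by auto
  then obtain N where N: "subgroup N G" "openin T N" "N \<subseteq> {y \<in> carrier G. x \<otimes> y \<in> U}"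
    by (rule open_subgroup_nhd)
  have "\<xi> \<in> evaluation G T ` U"
    if \<xi>: "\<xi> \<in> characters (dual_group G T) (dual_topology G T)"
      and near: "\<forall>\<phi>\<in>annihilator G T N. dist (\<xi> \<phi>) (\<alpha> \<phi>) < 1" for \<xi>
  proof -
    obtain y where y: "y \<in> carrier G" "\<xi> = evaluation G T y"
      using evaluation_surj[OF \<xi>] by blast
    have "inv x \<otimes> y \<in> N"
    proof (rule ccontr)
      assume "inv x \<otimes> y \<notin> N"
      then obtain \<phi> where \<phi>: "\<phi> \<in> annihilator G T N" "1 \<le> dist (\<phi> (inv x \<otimes> y)) 1"
        using annihilator_separates[OF N(1,2), of "inv x \<otimes> y"] xG y(1) by auto
      then have char: "\<phi> \<in> characters G T"
        by (simp add: annihilator_def)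
      have "dist (\<phi> y) (\<phi> x) < 1"
        using near \<phi>(1) char by (auto simp: x(2) y(2) evaluation_def)
      moreover have "\<phi> (inv x \<otimes> y) - 1 = cnj (\<phi> x) * (\<phi> y - \<phi> x)"
        using characterD(2)[OF char] character_inv[OF char xG] xG y(1)
          cnj_mult_self_eq_1[OF characterD(1)[OF char xG]] by (simp add: algebra_simps)
      then have "dist (\<phi> (inv x \<otimes> y)) 1 = dist (\<phi> y) (\<phi> x)"
        using characterD(1)[OF char xG] by (simp add: dist_norm norm_mult)
      ultimately show False
        using \<phi>(2) by simp
    qed
    then have "x \<otimes> (inv x \<otimes> y) \<in> U"
      using N(3) by blast
    then have "y \<in> U"
      using xG y(1) by (simp flip: m_assoc)
    with y(2) show ?thesis
      by blast
  qed
  moreover have "compactin (dual_topology G T) (annihilator G T N)"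
    using N(1,2) by (rule compactin_annihilator)
  ultimately show "\<exists>C e. compactin (dual_topology G T) C \<and> 0 < e \<and>
      {\<xi> \<in> characters (dual_group G T) (dual_topology G T). \<forall>\<phi>\<in>C. dist (\<xi> \<phi>) (\<alpha> \<phi>) < e}
      \<subseteq> evaluation G T ` U"
    by (intro exI[of _ "annihilator G T N"] exI[of _ 1]) auto
qed

text \<open>On the translate by \<open>x\<close> of the common kernel, the characters in
  \<open>C\<close> take exactly their values at \<open>x\<close>, so one neighbourhood serves for
  every radius \<open>e\<close>.\<close>

lemma (in P_ab_group) continuous_evaluation:
  assumes "\<And>C. compactin (dual_topology G T) C \<Longrightarrow> openin T {x \<in> carrier G. \<forall>\<phi>\<in>C. \<phi> x = 1}"
  shows "continuous_map T (bidual_topology G T) (evaluation G T)"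
  unfolding continuous_map_def topspace_dual_topology topspace_eq
proof (intro conjI allI impI)
  show "evaluation G T \<in> carrier G \<rightarrow> characters (dual_group G T) (dual_topology G T)"
    using evaluation_mem_characters by blast
  fix U assume U: "openin (bidual_topology G T) U"
  show "openin T {x \<in> carrier G. evaluation G T x \<in> U}"
  proof (subst openin_subopen, intro ballI)
    fix x assume "x \<in> {x \<in> carrier G. evaluation G T x \<in> U}"
    then have x: "x \<in> carrier G" "evaluation G T x \<in> U"
      by auto
    then obtain C e where C: "compactin (dual_topology G T) C" "0 < e"
      and sub: "{\<xi> \<in> characters (dual_group G T) (dual_topology G T).
          \<forall>\<phi>\<in>C. dist (\<xi> \<phi>) (evaluation G T x \<phi>) < e} \<subseteq> U"
      using U unfolding openin_dual_topology by meson
    have CX: "C \<subseteq> characters G T"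
      using compactin_subset_topspace[OF C(1)] unfolding topspace_dual_topology .
    let ?N = "{x \<in> carrier G. \<forall>\<phi>\<in>C. \<phi> x = 1}"
    let ?V = "{y \<in> carrier G. inv x \<otimes> y \<in> ?N}"
    have "openin T ?V"
      using x assms[OF C(1)] by (intro openin_translation) auto
    moreover have "x \<in> ?V"
      using x CX character_one by auto
    moreover have "?V \<subseteq> {x \<in> carrier G. evaluation G T x \<in> U}"
    proof
      fix y assume y: "y \<in> ?V"
      have "evaluation G T y \<phi> = evaluation G T x \<phi>" if "\<phi> \<in> C" for \<phi>
      proof -
        have char: "\<phi> \<in> characters G T"
          using that CX by blast
        have "\<phi> (x \<otimes> (inv x \<otimes> y)) = \<phi> x * \<phi> (inv x \<otimes> y)"
          using characterD(2)[OF char] x y by simp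
        then show ?thesis
          using char x y that by (simp add: evaluation_def flip: m_assoc)
      qed
      then have "evaluation G T y \<in> U"
        using y C(2) evaluation_mem_characters[of y] by (intro subsetD[OF sub]) auto
      with y show "y \<in> {x \<in> carrier G. evaluation G T x \<in> U}"
        by blast
    qed
    ultimately show "\<exists>V. openin T V \<and> x \<in> V \<and> V \<subseteq> {x \<in> carrier G. evaluation G T x \<in> U}"
      by meson
  qed
qed

lemma (in P_ab_group) reflexiveI:
  assumes "\<And>C. compactin (dual_topology G T) C \<Longrightarrow> openin T {x \<in> carrier G. \<forall>\<phi>\<in>C. \<phi> x = 1}"
  shows "reflexive_group G T"
  unfolding reflexive_group_def
proof (intro conjI)
  show "topological_abelian_group G T"
    using topological comm_group_axioms by (simp add: topological_abelian_group_def)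
  show "evaluation G T \<in> iso G (bidual_group G T)"
    using evaluation_hom inj_on_evaluation evaluation_image by (simp add: iso_def bij_betw_def)
  show "homeomorphic_map T (bidual_topology G T) (evaluation G T)"
    using continuous_evaluation[OF assms] openin_evaluation_image inj_on_evaluation evaluation_image
    by (intro bijective_open_imp_homeomorphic_map)
      (auto simp: open_map_def topspace_eq topspace_dual_topology)
qed

text \<open>
  In a \<open>P\<close>-group equicontinuity of a set of characters at \<open>\<one>\<close>, for all \<open>e = 1 / n\<close> at once,
  means that the characters have a common open kernel.
\<close>

lemma (in P_ab_group) reflexive_imp_openin_common_kernel:
  assumes "reflexive_group G T" and C: "compactin (dual_topology G T) C"
  shows "openin T {x \<in> carrier G. \<forall>\<phi>\<in>C. \<phi> x = 1}" (is "openin T ?N")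
proof -
  have cont: "continuous_map T (bidual_topology G T) (evaluation G T)"
    using assms(1) homeomorphic_imp_continuous_map by (auto simp: reflexive_group_def)
  have CX: "C \<subseteq> characters G T"
    using compactin_subset_topspace[OF C] unfolding topspace_dual_topology .
  let ?XX = "characters (dual_group G T) (dual_topology G T)"
  \<comment> \<open>A single bound \<open>r < e\<close> on all of \<open>C\<close> leaves the room
    \<open>(e - r) / 2\<close> that makes \<open>W e\<close> open.\<close>
  define W where "W e = {\<xi> \<in> ?XX. \<exists>r<e. \<forall>\<phi>\<in>C. dist (\<xi> \<phi>) 1 \<le> r}" for e :: real
  have W: "openin (bidual_topology G T) (W e)" for e
    unfolding openin_dual_topology
  proof (intro conjI ballI)
    show "W e \<subseteq> ?XX"
      by (auto simp: W_def)
    fix \<xi> assume "\<xi> \<in> W e"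
    then obtain r where r: "r < e" "\<forall>\<phi>\<in>C. dist (\<xi> \<phi>) 1 \<le> r"
      by (auto simp: W_def)
    have "\<xi>' \<in> W e" if \<xi>': "\<xi>' \<in> ?XX" "\<forall>\<phi>\<in>C. dist (\<xi>' \<phi>) (\<xi> \<phi>) < (e - r) / 2" for \<xi>'
    proof -
      have "dist (\<xi>' \<phi>) 1 \<le> (e + r) / 2" if "\<phi> \<in> C" for \<phi>
      proof -
        have "dist (\<xi>' \<phi>) 1 \<le> dist (\<xi>' \<phi>) (\<xi> \<phi>) + dist (\<xi> \<phi>) 1"
          by (rule dist_triangle)
        also have "\<dots> \<le> (e - r) / 2 + r"
          using \<xi>'(2) r(2) that by (intro add_mono) auto
        finally show ?thesis
          by (simp add: field_simps)
      qed
      moreover have "(e + r) / 2 < e"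
        using r(1) by simp
      ultimately show ?thesis
        using \<xi>'(1) unfolding W_def by blast
    qed
    then show "\<exists>D d. compactin (dual_topology G T) D \<and> 0 < d \<and>
        {\<xi>' \<in> ?XX. \<forall>\<phi>\<in>D. dist (\<xi>' \<phi>) (\<xi> \<phi>) < d} \<subseteq> W e"
      using C r(1) by (intro exI[of _ C] exI[of _ "(e - r) / 2"]) auto
  qed
  define U where "U n = {x \<in> topspace T. evaluation G T x \<in> W (1 / real (Suc n))}" for n
  have "openin T (\<Inter>n. U n)"
    unfolding U_def using W openin_continuous_map_preimage[OF cont] by (intro openin_INT_nat) auto
  moreover have "(\<Inter>n. U n) = ?N"
  proof
    show "(\<Inter>n. U n) \<subseteq> ?N"
    proof clarify
      fix x assume x: "x \<in> (\<Inter>n. U n)"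
      then have xG: "x \<in> carrier G"
        by (auto simp: U_def topspace_eq)
      have "\<phi> x = 1" if \<phi>: "\<phi> \<in> C" for \<phi>
      proof (rule ccontr)
        assume "\<phi> x \<noteq> 1"
        then obtain n where n: "1 / real (Suc n) < dist (\<phi> x) 1"
          using nat_approx_posE[of "dist (\<phi> x) 1"] by auto
        have "evaluation G T x \<in> W (1 / real (Suc n))"
          using x by (auto simp: U_def)
        then have "dist (evaluation G T x \<phi>) 1 < 1 / real (Suc n)"
          using \<phi> by (force simp: W_def)
        with n show False
          using \<phi> CX by (auto simp: evaluation_def subset_iff)
      qed
      with xG show "x \<in> carrier G \<and> (\<forall>\<phi>\<in>C. \<phi> x = 1)"
        by blast
    qed
    show "?N \<subseteq> (\<Inter>n. U n)"
    proof clarify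
      fix x n assume x: "x \<in> carrier G" "\<forall>\<phi>\<in>C. \<phi> x = 1"
      then have "\<forall>\<phi>\<in>C. dist (evaluation G T x \<phi>) 1 \<le> 0"
        using CX by (auto simp: evaluation_def subset_iff)
      moreover have "0 < 1 / real (Suc n)"
        by simp
      ultimately have "evaluation G T x \<in> W (1 / real (Suc n))"
        unfolding W_def using evaluation_mem_characters[OF x(1)] by blast
      with x(1) show "x \<in> U n"
        by (simp add: U_def topspace_eq)
    qed
  qed
  ultimately show ?thesis
    by simp
qed

section \<open>Transfer of reflexivity along a continuous homomorphism\<close>

lemma continuous_map_dual:
  assumes "topological_ab_group G TG" "topological_ab_group H TH"
    and h: "h \<in> hom G H" "continuous_map TG TH h"
  shows "continuous_map (dual_topology H TH) (dual_topology G TG) (\<lambda>\<phi>. \<lambda>x\<in>carrier G. \<phi> (h x))"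
proof -
  interpret G: topological_ab_group G TG by fact
  interpret H: topological_ab_group H TH by fact
  let ?h = "\<lambda>\<phi>. \<lambda>x\<in>carrier G. \<phi> (h x)"
  have hG: "h x \<in> carrier H" if "x \<in> carrier G" for x
    using h(1) that by (rule hom_in_carrier)
  have mem: "?h \<phi> \<in> characters G TG" if \<phi>: "\<phi> \<in> characters H TH" for \<phi>
  proof (rule G.characterI)
    have "\<phi> (h (x \<otimes>\<^bsub>G\<^esub> y)) = \<phi> (h x) * \<phi> (h y)" if "x \<in> carrier G" "y \<in> carrier G" for x y
      using H.characterD(2)[OF \<phi>] hG that hom_mult[OF h(1)] by simp
    then show "?h \<phi> \<in> hom G circle_group"
      using H.characterD(1)[OF \<phi>] hG by (simp add: hom_circle_group_iff)
    have "continuous_map TG euclidean (\<phi> \<circ> h)"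
      using h(2) H.characterD(4)[OF \<phi>] by (rule continuous_map_compose)
    then show "continuous_map TG euclidean (?h \<phi>)"
      by (rule continuous_map_eq) (simp add: G.topspace_eq)
  qed simp
  show ?thesis
    unfolding continuous_map_def topspace_dual_topology
  proof (intro conjI allI impI)
    show "?h \<in> characters H TH \<rightarrow> characters G TG"
      using mem by blast
    fix U assume U: "openin (dual_topology G TG) U"
    show "openin (dual_topology H TH) {\<phi> \<in> characters H TH. ?h \<phi> \<in> U}"
      unfolding openin_dual_topology
    proof (intro conjI ballI)
      fix \<phi> assume "\<phi> \<in> {\<phi> \<in> characters H TH. ?h \<phi> \<in> U}"
      then have "\<phi> \<in> characters H TH \<and> ?h \<phi> \<in> U"
        by (rule CollectD)
      then have "?h \<phi> \<in> U"
        by (rule conjunct2)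
      then obtain C e where C: "compactin TG C" "0 < e"
        "{\<psi> \<in> characters G TG. \<forall>x\<in>C. dist (\<psi> x) (?h \<phi> x) < e} \<subseteq> U"
        using U unfolding openin_dual_topology by meson
      have CG: "C \<subseteq> carrier G"
        using compactin_subset_topspace[OF C(1)] G.topspace_eq by simp
      \<comment> \<open>Closeness on the image of \<open>C\<close> under \<open>h\<close>, which is
        compact, is closeness of the pullbacks on \<open>C\<close>.\<close>
      have "?h \<psi> \<in> U" if \<psi>: "\<psi> \<in> characters H TH" "\<forall>y\<in>h ` C. dist (\<psi> y) (\<phi> y) < e" for \<psi>
      proof (rule subsetD[OF C(3)])
        have "\<forall>x\<in>C. dist (?h \<psi> x) (?h \<phi> x) < e"
          using \<psi>(2) CG by auto
        then show "?h \<psi> \<in> {\<psi> \<in> characters G TG. \<forall>x\<in>C. dist (\<psi> x) (?h \<phi> x) < e}"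
          using mem[OF \<psi>(1)] by blast
      qed
      moreover have "compactin TH (h ` C)"
        using C(1) h(2) by (rule image_compactin)
      ultimately show "\<exists>D e. compactin TH D \<and> 0 < e \<and>
          {\<psi> \<in> characters H TH. \<forall>y\<in>D. dist (\<psi> y) (\<phi> y) < e}
          \<subseteq> {\<phi> \<in> characters H TH. ?h \<phi> \<in> U}"
        using C(2) by (intro exI[of _ "h ` C"] exI[of _ e]) blast
    qed blast
  qed
qed

text \<open>The nature of \<open>h\<close> is confined to \<open>open_sub\<close>. That premise
  speaks of closed \<open>M\<close> only, as common kernels are closed; for the inclusion of a
  proper dense subgroup it would fail at \<open>M = carrier G\<close> otherwise, since open
  subgroups are closed.\<close>

lemma reflexive_P_group_transfer:
  assumes G: "P_ab_group G TG" and H: "P_ab_group H TH" and refl: "reflexive_group G TG"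
    and h: "h \<in> hom G H" "continuous_map TG TH h"
    and open_sub: "\<And>M. subgroup M H \<Longrightarrow> closedin TH M \<Longrightarrow> openin TG {x \<in> carrier G. h x \<in> M} \<Longrightarrow>
      openin TH M"
  shows "reflexive_group H TH"
proof -
  interpret G: P_ab_group G TG by fact
  interpret H: P_ab_group H TH by fact
  show ?thesis
  proof (rule H.reflexiveI)
    fix C assume C: "compactin (dual_topology H TH) C"
    let ?h = "\<lambda>\<phi>. \<lambda>x\<in>carrier G. \<phi> (h x)"
    let ?M = "{x \<in> carrier H. \<forall>\<phi>\<in>C. \<phi> x = 1}"
    have CX: "\<phi> \<in> characters H TH" if "\<phi> \<in> C" for \<phi>
      using compactin_subset_topspace[OF C] that by (auto simp: topspace_dual_topology)
    have "compactin (dual_topology G TG) (?h ` C)"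
      using C continuous_map_dual[OF G.topological_ab_group_axioms H.topological_ab_group_axioms h]
      by (rule image_compactin)
    then have "openin TG {x \<in> carrier G. \<forall>\<phi>\<in>?h ` C. \<phi> x = 1}"
      by (rule G.reflexive_imp_openin_common_kernel[OF refl])
    moreover have "{x \<in> carrier G. \<forall>\<phi>\<in>?h ` C. \<phi> x = 1} = {x \<in> carrier G. h x \<in> ?M}"
      using hom_in_carrier[OF h(1)] by auto
    ultimately have "openin TG {x \<in> carrier G. h x \<in> ?M}"
      by (simp only:)
    moreover have "subgroup ?M H"
    proof (rule H.subgroupI)
      show "?M \<noteq> {}"
        using H.character_one[OF CX] by blast
      show "inv\<^bsub>H\<^esub> x \<in> ?M" if "x \<in> ?M" for x
      proof -
        have "\<phi> (inv\<^bsub>H\<^esub> x) = 1" if "\<phi> \<in> C" for \<phi>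
          using H.character_inv[OF CX[OF that], of x] \<open>x \<in> ?M\<close> that by simp
        then show ?thesis
          using that by simp
      qed
      show "x \<otimes>\<^bsub>H\<^esub> y \<in> ?M" if "x \<in> ?M" "y \<in> ?M" for x y
      proof -
        have "\<phi> (x \<otimes>\<^bsub>H\<^esub> y) = 1" if "\<phi> \<in> C" for \<phi>
        proof -
          have "\<phi> x = 1" "\<phi> y = 1"
            using \<open>x \<in> ?M\<close> \<open>y \<in> ?M\<close> that by blast+
          then show ?thesis
            using H.characterD(2)[OF CX[OF that], of x y] \<open>x \<in> ?M\<close> \<open>y \<in> ?M\<close> by simp
        qed
        then show ?thesis
          using that by simp
      qed
    qed blast
    moreover have "closedin TH ?M"
    proof -
      have "closedin TH {x \<in> topspace TH. \<phi> x \<in> {1}}" if "\<phi> \<in> C" for \<phi>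
        using H.characterD(4)[OF CX[OF that]] by (rule closedin_continuous_map_preimage) simp
      \<comment> \<open>Inserting \<open>topspace TH\<close> keeps the family nonempty and the
        intersection inside the carrier when \<open>C\<close> is empty.\<close>
      then have "closedin TH (\<Inter>(insert (topspace TH) ((\<lambda>\<phi>. {x \<in> topspace TH. \<phi> x \<in> {1}}) ` C)))"
        by (intro closedin_Inter) auto
      moreover have "\<Inter>(insert (topspace TH) ((\<lambda>\<phi>. {x \<in> topspace TH. \<phi> x \<in> {1}}) ` C)) = ?M"
        by (auto simp: H.topspace_eq)
      ultimately show ?thesis
        by (simp only:)
    qed
    ultimately show "openin TH ?M"
      by (intro open_sub)
  qed
qed

section \<open>The P-property for dense extensions and open images\<close>

lemma topological_ab_groupI:
  "topological_abelian_group G T \<Longrightarrow> topological_ab_group G T"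
  by (simp add: topological_abelian_group_def topological_ab_group_def topological_ab_group_axioms_def)

lemma P_ab_groupI:
  "topological_abelian_group G T \<Longrightarrow> P_group G T \<Longrightarrow> P_ab_group G T"
  by (simp add: topological_ab_groupI P_ab_group_def P_ab_group_axioms_def)

text \<open>The open set \<open>U - W\<close> misses \<open>D\<close>, so density leaves it empty.
  Inclusions on a dense subgroup pass to the whole group in this way.\<close>

lemma open_subset_closed_of_dense:
  assumes "X closure_of D = topspace X" "openin X U" "closedin X W" "U \<inter> D \<subseteq> W"
  shows "U \<subseteq> W"
proof
  fix x assume x: "x \<in> U"
  show "x \<in> W"
  proof (rule ccontr)
    assume "x \<notin> W"
    have "x \<in> X closure_of D"
      using assms(1,2) x openin_subset by blast
    moreover have "openin X (U - W)" "x \<in> U - W"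
      using assms(2,3) x \<open>x \<notin> W\<close> by auto
    ultimately obtain y where "y \<in> D" "y \<in> U - W"
      unfolding in_closure_of by meson
    with assms(4) show False
      by blast
  qed
qed

text \<open>Density gives containment in closed sets, hence the closed \<open>W n\<close> between
  \<open>V n\<close> and \<open>U n\<close>. The traces of the \<open>V n\<close> on
  \<open>G\<close> intersect in the trace of some open \<open>Q\<close>, and density puts
  \<open>Q\<close> inside every \<open>W n\<close>.\<close>

lemma P_group_of_dense_subgroup:
  assumes G: "P_ab_group G TG" and H: "topological_ab_group H TH"
    and dense: "dense_topological_subgroup G TG H TH"
  shows "P_group H TH"
proof -
  interpret G: P_ab_group G TG by fact
  interpret H: topological_ab_group H TH by fact
  have sub: "subgroup (carrier G) H" and TG: "TG = subtopology TH (carrier G)"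
    and cl: "TH closure_of carrier G = topspace TH"
    using dense by (auto simp: dense_topological_subgroup_def H.topspace_eq)
  show ?thesis
  proof (rule H.P_groupI)
    fix U :: "nat \<Rightarrow> 'a set"
    assume U: "\<And>n. openin TH (U n)" "\<And>n. \<one>\<^bsub>H\<^esub> \<in> U n"
    have "\<forall>n. \<exists>V W. openin TH V \<and> closedin TH W \<and> \<one>\<^bsub>H\<^esub> \<in> V \<and> V \<subseteq> W \<and> W \<subseteq> U n"
    proof
      fix n
      obtain V W where "openin TH V" "closedin TH W" "\<one>\<^bsub>H\<^esub> \<in> V" "V \<subseteq> W" "W \<subseteq> U n"
        using U by (rule H.closedin_nhd)
      then show "\<exists>V W. openin TH V \<and> closedin TH W \<and> \<one>\<^bsub>H\<^esub> \<in> V \<and> V \<subseteq> W \<and> W \<subseteq> U n"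
        by blast
    qed
    then obtain V W where VW: "\<forall>n. openin TH (V n) \<and> closedin TH (W n) \<and> \<one>\<^bsub>H\<^esub> \<in> V n \<and>
        V n \<subseteq> W n \<and> W n \<subseteq> U n"
      by metis
    have "openin TG (V n \<inter> carrier G)" for n
      using VW by (auto simp: TG openin_subtopology)
    then have "openin TG (\<Inter>n. V n \<inter> carrier G)"
      by (rule G.openin_INT_nat)
    then obtain Q where Q: "openin TH Q" "(\<Inter>n. V n \<inter> carrier G) = Q \<inter> carrier G"
      by (auto simp: TG openin_subtopology)
    have "\<one>\<^bsub>H\<^esub> \<in> (\<Inter>n. V n \<inter> carrier G)"
      using VW subgroup.one_closed[OF sub] by blast
    then have "\<one>\<^bsub>H\<^esub> \<in> Q"
      using Q(2) by blast
    moreover have "Q \<subseteq> W n" for n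
    proof (rule open_subset_closed_of_dense[OF cl Q(1)])
      show "closedin TH (W n)"
        using VW by blast
      have "Q \<inter> carrier G \<subseteq> V n"
        unfolding Q(2)[symmetric] by blast
      then show "Q \<inter> carrier G \<subseteq> W n"
        using VW by blast
    qed
    ultimately show "\<exists>V. openin TH V \<and> \<one>\<^bsub>H\<^esub> \<in> V \<and> V \<subseteq> (\<Inter>n. U n)"
      using Q(1) VW by (intro exI[of _ Q]) blast
  qed
qed

text \<open>The preimage of a G-delta set is open in \<open>G\<close>, and surjectivity recovers the
  set as the image of its preimage.\<close>

lemma P_group_of_open_image:
  assumes G: "P_ab_group G TG" and K: "topological_ab_group K TK"
    and \<pi>: "\<pi> ` carrier G = carrier K" "continuous_map TG TK \<pi>" "open_map TG TK \<pi>"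
  shows "P_group K TK"
proof -
  interpret G: P_ab_group G TG by fact
  interpret K: topological_ab_group K TK by fact
  show ?thesis
    unfolding P_group_def
  proof (intro conjI allI impI K.topological)
    fix S assume S: "gdelta_in TK S"
    then obtain U :: "nat \<Rightarrow> _" where U: "\<And>n. openin TK (U n)" "S = (\<Inter>n. U n)"
      using gdelta_in_imp_INT_nat[OF S] by blast
    have "openin TG (\<Inter>n. {x \<in> topspace TG. \<pi> x \<in> U n})"
      using openin_continuous_map_preimage[OF \<pi>(2) U(1)] by (rule G.openin_INT_nat)
    then have "openin TK (\<pi> ` (\<Inter>n. {x \<in> topspace TG. \<pi> x \<in> U n}))"
      using \<pi>(3) by (simp add: open_map_def)
    moreover have "\<pi> ` (\<Inter>n. {x \<in> topspace TG. \<pi> x \<in> U n}) = S"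
    proof (intro subset_antisym subsetI)
      show "y \<in> S" if "y \<in> \<pi> ` (\<Inter>n. {x \<in> topspace TG. \<pi> x \<in> U n})" for y
        using that by (auto simp: U(2))
      fix y assume y: "y \<in> S"
      then have "y \<in> \<pi> ` carrier G"
        using gdelta_in_subset[OF S] unfolding \<pi>(1) K.topspace_eq by (rule subsetD[rotated])
      then obtain x where x: "x \<in> carrier G" "y = \<pi> x"
        by blast
      then have "x \<in> (\<Inter>n. {x \<in> topspace TG. \<pi> x \<in> U n})"
        using y by (simp add: U(2) G.topspace_eq)
      with x(2) show "y \<in> \<pi> ` (\<Inter>n. {x \<in> topspace TG. \<pi> x \<in> U n})"
        by (rule image_eqI)
    qed
    ultimately show "openin TK S"
      by simp
  qed
qed

theorem theorem7:
  fixes G :: "('a, 'm) monoid_scheme" and TG :: "'a topology"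
  assumes "topological_abelian_group G TG"
    and "P_group G TG"
    and "reflexive_group G TG"
  shows
    "(\<forall>(H :: ('a, 'n) monoid_scheme) TH.
        topological_abelian_group H TH \<longrightarrow>
        dense_topological_subgroup G TG H TH \<longrightarrow>
        reflexive_group H TH \<and> P_group H TH) \<and>
     (\<forall>(K :: ('b, 'k) monoid_scheme) TK \<pi>.
        topological_abelian_group K TK \<longrightarrow>
        \<pi> \<in> hom G K \<longrightarrow>
        \<pi> ` carrier G = carrier K \<longrightarrow>
        continuous_map TG TK \<pi> \<longrightarrow>
        open_map TG TK \<pi> \<longrightarrow>
        reflexive_group K TK \<and> P_group K TK)"
proof (intro conjI allI impI)
  have G: "P_ab_group G TG"
    using assms(1,2) by (rule P_ab_groupI)
  interpret G: P_ab_group G TG by (rule G)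
  {
    fix H :: "('a, 'n) monoid_scheme" and TH
    assume H: "topological_abelian_group H TH" and dense: "dense_topological_subgroup G TG H TH"
    show P: "P_group H TH"
      using G topological_ab_groupI[OF H] dense by (rule P_group_of_dense_subgroup)
    then interpret H: P_ab_group H TH
      by (rule P_ab_groupI[OF H])
    have sub: "subgroup (carrier G) H" and TG: "TG = subtopology TH (carrier G)"
      and mult: "\<And>x y. x \<in> carrier G \<Longrightarrow> y \<in> carrier G \<Longrightarrow> x \<otimes>\<^bsub>G\<^esub> y = x \<otimes>\<^bsub>H\<^esub> y"
      and cl: "TH closure_of carrier G = topspace TH"
      using dense by (auto simp: dense_topological_subgroup_def H.topspace_eq)
    show "reflexive_group H TH"
    proof (rule reflexive_P_group_transfer[OF G H.P_ab_group_axioms assms(3)])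
      show "(\<lambda>x. x) \<in> hom G H"
        using subgroup.subset[OF sub] mult by (intro homI) auto
      show "continuous_map TG TH (\<lambda>x. x)"
        unfolding TG by (rule continuous_map_from_subtopology) simp
      \<comment> \<open>Some open \<open>Q\<close> has the same trace on \<open>G\<close> as
        \<open>M\<close>. Density and closedness of \<open>M\<close> put \<open>Q\<close> inside
        \<open>M\<close>, and a subgroup containing a neighbourhood of the identity is open.\<close>
      fix M assume M: "subgroup M H" "closedin TH M" "openin TG {x \<in> carrier G. x \<in> M}"
      obtain Q where Q: "openin TH Q" "{x \<in> carrier G. x \<in> M} = Q \<inter> carrier G"
        using M(3) by (auto simp: TG openin_subtopology)
      have "Q \<subseteq> M"
      proof (rule open_subset_closed_of_dense[OF cl Q(1) M(2)])
        show "Q \<inter> carrier G \<subseteq> M"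
          unfolding Q(2)[symmetric] by blast
      qed
      moreover have "\<one>\<^bsub>H\<^esub> \<in> Q"
        using subgroup.one_closed[OF sub] subgroup.one_closed[OF M(1)] Q(2) by blast
      ultimately show "openin TH M"
        using H.openin_subgroup[OF M(1) Q(1)] by blast
    qed
  next
    fix K :: "('b, 'k) monoid_scheme" and TK \<pi>
    assume K: "topological_abelian_group K TK" and \<pi>: "\<pi> \<in> hom G K" "\<pi> ` carrier G = carrier K"
      "continuous_map TG TK \<pi>" "open_map TG TK \<pi>"
    show P: "P_group K TK"
      using G topological_ab_groupI[OF K] \<pi>(2-4) by (rule P_group_of_open_image)
    then interpret K: P_ab_group K TK
      by (rule P_ab_groupI[OF K])
    show "reflexive_group K TK"
    proof (rule reflexive_P_group_transfer[OF G K.P_ab_group_axioms assms(3) \<pi>(1,3)])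
      fix M assume M: "subgroup M K" and "openin TG {x \<in> carrier G. \<pi> x \<in> M}"
      then have "openin TK (\<pi> ` {x \<in> carrier G. \<pi> x \<in> M})"
        using \<pi>(4) by (simp add: open_map_def)
      moreover have "\<pi> ` {x \<in> carrier G. \<pi> x \<in> M} = M"
        using subgroup.subset[OF M] \<pi>(2) by fast
      ultimately show "openin TK M"
        by simp
    qed
  }
qed

end
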